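(* Let $\delta>0$, let $\Omega:=\mathcal{T}_\delta(\mathcal{A})$ be compact, let $k\in C^4(\operatorname{conv}(\Omega)\times\operatorname{conv}(\Omega))$ be a strictly positive definite kernel, let the value function $v$ be radially unbounded (that is, $v(x)\to\infty$ as $\|x\|_2\to\infty$) with $v\in\mathcal{H}_k(\Omega)$, and let $f,g\in C^1(\mathcal{T}_\delta(\mathcal{A}))$. Then for every $T>0$ there are constants $\overline{C}_T>0$ and $\tilde{C}_T>0$, independent of the tolerances $\epsilon_{tol,d},\epsilon_{tol,f}>0$ and of the respective Hermite kernel interpolant $s_v^n$, such that $$\max_{(t,x_0)\in[0,T]\times\mathcal{A}}\|\mathbf{x}^*(t;x_0)-\mathbf{x}_s(t;x_0)\|_2\le\epsilon_{tol,d}\,\overline{C}_T+\epsilon_{tol,f}\,\tilde{C}_T$$ whenever the Greedy exploration algorithm with tolerance $\epsilon_{tol,d}$ has terminated with data set $\mathcal{D}$, the Hermite VKOGA, run on $\mathcal{D}$ with tolerance $\epsilon_{tol,f}$, has terminated with output $s_v^n$, and the tolerances are so small that $\epsilon_{tol,d}\,\overline{C}_T+\epsilon_{tol,f}\,\tilde{C}_T<\delta$.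
   Context: **Optimal control problem.** Let $f:\mathbb{R}^N\to\mathbb{R}^N$, $g:\mathbb{R}^N\to\mathbb{R}^{N\times M}$, $f(0)=0$, let $r\in C(\mathbb{R}^N,\mathbb{R}_+)$ with $r^{-1}(\{0\})=\{0\}$, and let $R\in\mathbb{R}^{M\times M}$ be positive definite. Let $\mathcal{U}_\infty$ be the set of measurable $\mathbf{u}:[0,\infty)\to\mathbb{R}^M$. For an initial state $x$, the problem is to minimize $\int_0^\infty r(\mathbf{x}(s))+\mathbf{u}(s)^\top R\,\mathbf{u}(s)\,ds$ over $\mathbf{u}\in\mathcal{U}_\infty$ subject to $\dot{\mathbf{x}}(s)=f(\mathbf{x}(s))+g(\mathbf{x}(s))\mathbf{u}(s)$, $\mathbf{x}(0)=x$. The value function $v(x)$ is the minimal cost. $\mathcal{A}\subset\mathbb{R}^N$ is a non-empty compact set such that for every $x_0\in\mathcal{A}$ there is an optimal process $(\mathbf{x}^*(\cdot;x_0),\mathbf{u}^*(\cdot;x_0))$. $\mathcal{T}(\mathcal{A})$ is the closure of $\{\mathbf{x}^*(t;x_0): x_0\in\mathcal{A},\ t\in[0,\infty)\}$, and $\mathcal{T}_\delta(\mathcal{A}):=\mathcal{T}(\mathcal{A})+\overline{B_\delta}$, where $\overline{B_\delta}$ is the closed ball of radius $\delta$ centered at zero. Optimal controls are given by the feedback rule $\mathbf{u}^*(s)=-\frac12R^{-1}g(\mathbf{x}^*(s))^\top\nabla v(\mathbf{x}^*(s))$, so optimal trajectories satisfy $\dot{\mathbf{x}}^*=f(\mathbf{x}^*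 )-\frac12g(\mathbf{x}^* )R^{-1}g(\mathbf{x}^* )^\top\nabla v(\mathbf{x}^* )$. Moreover $v(0)=0$ and $\nabla v(0)=0$. **Kernels.** A kernel on a set is a symmetric real-valued function $k$ of two arguments; it is strictly positive definite if all Gram matrices $(k(x_i,x_j))_{i,j}$ for finitely many pairwise distinct points are positive definite. $\mathcal{H}_k(\Omega)$ is the reproducing kernel Hilbert space of $k$ (restricted to $\Omega\times\Omega$). $\operatorname{conv}$ is the convex hull. $\nabla_1$, $\partial_{1,i}$ act on the first argument of $k$. For $h\in\mathcal{H}_k(\Omega)$, $x\in\Omega$: $h(x)=\langle k(x,\cdot),h\rangle_{\mathcal{H}_k(\Omega)}$ and $\partial_i h(x)=\langle\partial_{1,i}k(x,\cdot),h\rangle_{\mathcal{H}_k(\Omega)}$. $C^m$ functions on compact sets are understood to be $C^m$ on a neighbourhood. **Hermite kernel interpolant.** For a finite set $X_n=\{x_1,\dots,x_n\}\subset\Omega$ of pairwise distinct points, $s_v^n(x)=\sum_{i=1}^n\alpha_ik(x_i,x)+\langle\beta_i,\nabla_1k(x_i,x)\rangle$ with $\alpha_i\in\mathbb{R}$, $\beta_i\in\mathbb{R}^N$ such that $s_v^n(x_j)=v(x_j)$ and $\nabla s_v^n(x_j)=\nabla v(x_j)$ for $j=1,\dots,n$. **Surrogate controlled trajectory.** $\mathbf{x}_s(\cdot;x_0)$ is the solution of $\dot{\mathbf{x}}_s(t;x_0)=f(\mathbf{x}_s)-\frac12g(\mathbf{x}_s)R^{-1}g(\mathbf{x}_s)^\top\nabla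 s_v^n(\mathbf{x}_s)$, $\mathbf{x}_s(0;x_0)=x_0$. **Greedy exploration algorithm** (tolerance $\epsilon_{tol,d}$). Start with $\mathcal{D}=\{0\}$ and $\epsilon:=\epsilon_{tol,d}+1$. While $\epsilon>\epsilon_{tol,d}$: choose $x_a\in\arg\max_{x\in\mathcal{A}}\min_{y\in\mathcal{D}}\|x-y\|_2$; set $\epsilon:=\min_{y\in\mathcal{D}}\|x_a-y\|_2$; replace $\mathcal{D}$ by $\mathcal{D}\cup\{\mathbf{x}^*(t;x_a):t\in[0,\infty)\}$. The output is $\mathcal{D}\subset\mathcal{T}(\mathcal{A})$ with the exact values $v(\mathcal{D})$ and $\nabla v(\mathcal{D})$. **Hermite VKOGA** (tolerance $\epsilon_{tol,f}$). Start with $X=\emptyset$, $s_v=0$. While $\max_{x\in\mathcal{D}\setminus X}(|v(x)-s_v(x)|+\|\nabla v(x)-\nabla s_v(x)\|_2)>\epsilon_{tol,f}$: add to $X$ a maximizer over $\mathcal{D}\setminus X$ of $|v(x)-s_v(x)|+\|\nabla v(x)-\nabla s_v(x)\|_2$, and let $s_v$ be the Hermite kernel interpolant of $v$ at the points of $X$. The output is the final $s_v=s_v^n$, $n=|X|$. *)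

theory Defs
  imports "HOL-Analysis.Analysis"
begin

section \<open>Calculus\<close>

definition grad :: "('a::euclidean_space \<Rightarrow> real) \<Rightarrow> 'a \<Rightarrow> 'a" where
  "grad h x = (THE d. GDERIV h x :> d)"

text \<open>Meant for open \<open>U\<close>: all directional derivatives of a \<open>C\<^sup>m\<^sup>+\<^sup>1\<close> function are \<open>C\<^sup>m\<close>.\<close>

primrec Cm_on :: "nat \<Rightarrow> 'a::euclidean_space set \<Rightarrow> ('a \<Rightarrow> 'b::euclidean_space) \<Rightarrow> bool" where
  "Cm_on 0 U h = continuous_on U h"
| "Cm_on (Suc m) U h =
    (\<exists>h'. (\<forall>x\<in>U. (h has_derivative h' x) (at x)) \<and> (\<forall>w. Cm_on m U (\<lambda>x. h' x w)))"

definition Cm_near :: "nat \<Rightarrow> 'a::euclidean_space set \<Rightarrow> ('a \<Rightarrow> 'b::euclidean_space) \<Rightarrow> bool" where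
  "Cm_near m S h \<longleftrightarrow> (\<exists>U. open U \<and> S \<subseteq> U \<and> Cm_on m U h)"

section \<open>Optimal control\<close>

definition pos_def_matrix :: "real^'m^'m \<Rightarrow> bool" where
  "pos_def_matrix R \<longleftrightarrow> (\<forall>w. w \<noteq> 0 \<longrightarrow> 0 < w \<bullet> (R *v w))"

text \<open>
  The controls are merely measurable, so the state equation is understood in the sense of
  Caratheodory: the state is locally absolutely continuous and the equation holds almost
  everywhere, which is written here in its integrated form.
\<close>

definition control_process ::
  "(real^'n \<Rightarrow> real^'n) \<Rightarrow> (real^'n \<Rightarrow> real^'m^'n) \<Rightarrow> real^'n
     \<Rightarrow> (real \<Rightarrow> real^'n) \<Rightarrow> (real \<Rightarrow> real^'m) \<Rightarrow> bool" where
  "control_process f g x0 x u \<longleftrightarrow>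
     u \<in> borel_measurable (lebesgue_on {0..}) \<and>
     (\<forall>t\<ge>0. set_integrable lebesgue {0..t} (\<lambda>s. f (x s) + g (x s) *v u s) \<and>
            x t = x0 + set_lebesgue_integral lebesgue {0..t} (\<lambda>s. f (x s) + g (x s) *v u s))"

definition cost ::
  "(real^'n \<Rightarrow> real) \<Rightarrow> real^'m^'m \<Rightarrow> (real \<Rightarrow> real^'n) \<Rightarrow> (real \<Rightarrow> real^'m) \<Rightarrow> ennreal" where
  "cost r R x u = (\<integral>\<^sup>+ s\<in>{0..}. ennreal (r (x s) + u s \<bullet> (R *v u s)) \<partial>lebesgue)"

text \<open>The minimal cost may be infinite for some initial states; in particular it is so when
  no process starts there.\<close>

definition min_cost ::
  "(real^'n \<Rightarrow> real^'n) \<Rightarrow> (real^'n \<Rightarrow> real^'m^'n) \<Rightarrow> (real^'n \<Rightarrow> real) \<Rightarrow> real^'m^'m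
     \<Rightarrow> real^'n \<Rightarrow> ennreal" where
  "min_cost f g r R x0 = Inf {cost r R x u |x u. control_process f g x0 x u}"

text \<open>To be used only where the minimal cost is finite.\<close>

definition value_fun ::
  "(real^'n \<Rightarrow> real^'n) \<Rightarrow> (real^'n \<Rightarrow> real^'m^'n) \<Rightarrow> (real^'n \<Rightarrow> real) \<Rightarrow> real^'m^'m
     \<Rightarrow> real^'n \<Rightarrow> real" where
  "value_fun f g r R x0 = enn2real (min_cost f g r R x0)"

definition optimal_process ::
  "(real^'n \<Rightarrow> real^'n) \<Rightarrow> (real^'n \<Rightarrow> real^'m^'n) \<Rightarrow> (real^'n \<Rightarrow> real) \<Rightarrow> real^'m^'m
     \<Rightarrow> real^'n \<Rightarrow> (real \<Rightarrow> real^'n) \<Rightarrow> (real \<Rightarrow> real^'m) \<Rightarrow> bool" where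
  "optimal_process f g r R x0 x u \<longleftrightarrow>
     control_process f g x0 x u \<and>
     (\<forall>y w. control_process f g x0 y w \<longrightarrow> cost r R x u \<le> cost r R y w)"

definition feedback ::
  "(real^'n \<Rightarrow> real^'m^'n) \<Rightarrow> real^'m^'m \<Rightarrow> (real^'n \<Rightarrow> real) \<Rightarrow> real^'n \<Rightarrow> real^'m" where
  "feedback g R h x = - (1/2) *\<^sub>R (matrix_inv R *v (transpose (g x) *v grad h x))"

definition closed_loop_solution ::
  "(real^'n \<Rightarrow> real^'n) \<Rightarrow> (real^'n \<Rightarrow> real^'m^'n) \<Rightarrow> real^'m^'m \<Rightarrow> (real^'n \<Rightarrow> real)
     \<Rightarrow> real \<Rightarrow> real^'n \<Rightarrow> (real \<Rightarrow> real^'n) \<Rightarrow> bool" where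
  "closed_loop_solution f g R h T x0 y \<longleftrightarrow>
     y 0 = x0 \<and>
     (\<forall>t\<in>{0..T}. (y has_vector_derivative f (y t) + g (y t) *v feedback g R h (y t))
                   (at t within {0..T}))"

definition reach_set :: "('a::euclidean_space \<Rightarrow> real \<Rightarrow> 'a) \<Rightarrow> 'a set \<Rightarrow> 'a set" where
  "reach_set xstar A = closure {xstar x0 t |x0 t. x0 \<in> A \<and> 0 \<le> t}"

definition reach_tube :: "('a::euclidean_space \<Rightarrow> real \<Rightarrow> 'a) \<Rightarrow> 'a set \<Rightarrow> real \<Rightarrow> 'a set" where
  "reach_tube xstar A \<delta> = {x + b |x b. x \<in> reach_set xstar A \<and> b \<in> cball 0 \<delta>}"

section \<open>Kernels and Hermite interpolation\<close>

definition kernel_on :: "'a set \<Rightarrow> ('a \<Rightarrow> 'a \<Rightarrow> real) \<Rightarrow> bool" where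
  "kernel_on S k \<longleftrightarrow> (\<forall>x\<in>S. \<forall>y\<in>S. k x y = k y x)"

definition strictly_pos_def_on :: "'a set \<Rightarrow> ('a \<Rightarrow> 'a \<Rightarrow> real) \<Rightarrow> bool" where
  "strictly_pos_def_on S k \<longleftrightarrow>
     (\<forall>X c. finite X \<and> X \<subseteq> S \<and> (\<exists>x\<in>X. c x \<noteq> 0) \<longrightarrow>
            0 < (\<Sum>x\<in>X. \<Sum>y\<in>X. c x * k x y * c y))"

text \<open>A real function on \<open>S\<close> is represented by its extension by zero.\<close>

definition ext0 :: "'a set \<Rightarrow> ('a \<Rightarrow> real) \<Rightarrow> 'a \<Rightarrow> real" where
  "ext0 S h x = (if x \<in> S then h x else 0)"

definition is_rkhs ::
  "'a set \<Rightarrow> ('a \<Rightarrow> 'a \<Rightarrow> real) \<Rightarrow> ('a \<Rightarrow> real) set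
     \<Rightarrow> (('a \<Rightarrow> real) \<Rightarrow> ('a \<Rightarrow> real) \<Rightarrow> real) \<Rightarrow> bool" where
  "is_rkhs S k H ip \<longleftrightarrow>
     \<comment> \<open>a vector space of functions on \<open>S\<close>\<close>
     (\<forall>h\<in>H. \<forall>x. x \<notin> S \<longrightarrow> h x = 0) \<and>
     (\<lambda>_. 0) \<in> H \<and>
     (\<forall>h1\<in>H. \<forall>h2\<in>H. \<forall>a b. (\<lambda>x. a * h1 x + b * h2 x) \<in> H) \<and>
     \<comment> \<open>with an inner product\<close>
     (\<forall>h1\<in>H. \<forall>h2\<in>H. ip h1 h2 = ip h2 h1) \<and>
     (\<forall>h1\<in>H. \<forall>h2\<in>H. \<forall>h\<in>H. \<forall>a b.
        ip (\<lambda>x. a * h1 x + b * h2 x) h = a * ip h1 h + b * ip h2 h) \<and>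
     (\<forall>h\<in>H. 0 \<le> ip h h \<and> (ip h h = 0 \<longrightarrow> h = (\<lambda>_. 0))) \<and>
     \<comment> \<open>complete in the induced norm\<close>
     (\<forall>F :: nat \<Rightarrow> 'a \<Rightarrow> real.
        (\<forall>i. F i \<in> H) \<and>
        (\<forall>e>0. \<exists>n0. \<forall>i\<ge>n0. \<forall>j\<ge>n0.
           sqrt (ip (\<lambda>x. F i x - F j x) (\<lambda>x. F i x - F j x)) < e) \<longrightarrow>
        (\<exists>h\<in>H. (\<lambda>i. sqrt (ip (\<lambda>x. F i x - h x) (\<lambda>x. F i x - h x))) \<longlonglongrightarrow> 0)) \<and>
     \<comment> \<open>with reproducing kernel \<open>k\<close>\<close>
     (\<forall>x\<in>S. ext0 S (k x) \<in> H \<and> (\<forall>h\<in>H. h x = ip (ext0 S (k x)) h))"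

text \<open>By the Moore-Aronszajn theorem, the space with reproducing kernel \<open>k\<close> on \<open>S\<close> exists and
  is unique (for positive definite \<open>k\<close>), so this is membership in that space.\<close>

definition rkhs :: "'a set \<Rightarrow> ('a \<Rightarrow> 'a \<Rightarrow> real) \<Rightarrow> ('a \<Rightarrow> real) set" where
  "rkhs S k = {h. \<exists>H ip. is_rkhs S k H ip \<and> ext0 S h \<in> H}"

text \<open>The coefficients need not be unique: strict positive definiteness of \<open>k\<close> says nothing
  about linear independence of the derivative functionals.\<close>

definition hermite_interpolant ::
  "('a::euclidean_space \<Rightarrow> 'a \<Rightarrow> real) \<Rightarrow> ('a \<Rightarrow> real) \<Rightarrow> 'a set \<Rightarrow> ('a \<Rightarrow> real) \<Rightarrow> bool" where
  "hermite_interpolant k v X s \<longleftrightarrow>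
     (\<exists>\<alpha> \<beta>. s = (\<lambda>x. \<Sum>y\<in>X. \<alpha> y * k y x + \<beta> y \<bullet> grad (\<lambda>z. k z x) y)) \<and>
     (\<forall>y\<in>X. s y = v y \<and> grad s y = grad v y)"

section \<open>The algorithms\<close>

text \<open>States \<open>(D, \<epsilon>)\<close> reachable by the loop with tolerance \<open>tol\<close>; \<open>infdist x D\<close> is the
  distance of \<open>x\<close> to the nearest point of \<open>D\<close>.\<close>

inductive greedy_exploration ::
  "('a::euclidean_space \<Rightarrow> real \<Rightarrow> 'a) \<Rightarrow> 'a set \<Rightarrow> real \<Rightarrow> 'a set \<Rightarrow> real \<Rightarrow> bool"
  for xstar A tol where
  start: "greedy_exploration xstar A tol {0} (tol + 1)"
| step: "\<lbrakk>greedy_exploration xstar A tol D \<epsilon>; \<epsilon> > tol;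
          xa \<in> A; \<forall>x\<in>A. infdist x D \<le> infdist xa D\<rbrakk>
         \<Longrightarrow> greedy_exploration xstar A tol (D \<union> xstar xa ` {0..}) (infdist xa D)"

definition greedy_exploration_output ::
  "('a::euclidean_space \<Rightarrow> real \<Rightarrow> 'a) \<Rightarrow> 'a set \<Rightarrow> real \<Rightarrow> 'a set \<Rightarrow> bool" where
  "greedy_exploration_output xstar A tol D \<longleftrightarrow>
     (\<exists>\<epsilon>. greedy_exploration xstar A tol D \<epsilon> \<and> \<epsilon> \<le> tol)"

definition hermite_err :: "('a::euclidean_space \<Rightarrow> real) \<Rightarrow> ('a \<Rightarrow> real) \<Rightarrow> 'a \<Rightarrow> real" where
  "hermite_err v s x = \<bar>v x - s x\<bar> + norm (grad v x - grad s x)"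

inductive vkoga ::
  "('a::euclidean_space \<Rightarrow> 'a \<Rightarrow> real) \<Rightarrow> ('a \<Rightarrow> real) \<Rightarrow> 'a set \<Rightarrow> real
     \<Rightarrow> 'a set \<Rightarrow> ('a \<Rightarrow> real) \<Rightarrow> bool"
  for k v D tol where
  start: "vkoga k v D tol {} (\<lambda>_. 0)"
| step: "\<lbrakk>vkoga k v D tol X s; x \<in> D - X; hermite_err v s x > tol;
          \<forall>y\<in>D - X. hermite_err v s y \<le> hermite_err v s x;
          hermite_interpolant k v (insert x X) s'\<rbrakk>
         \<Longrightarrow> vkoga k v D tol (insert x X) s'"

definition vkoga_output ::
  "('a::euclidean_space \<Rightarrow> 'a \<Rightarrow> real) \<Rightarrow> ('a \<Rightarrow> real) \<Rightarrow> 'a set \<Rightarrow> real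
     \<Rightarrow> ('a \<Rightarrow> real) \<Rightarrow> bool" where
  "vkoga_output k v D tol s \<longleftrightarrow>
     (\<exists>X. vkoga k v D tol X s \<and> (\<forall>x\<in>D - X. hermite_err v s x \<le> tol))"

end

theory Submission
  imports Defs
begin

text \<open>
  Since the kernel is \<open>C\<^sup>4\<close>, the directional derivatives at an interior point \<open>x\<close> are bounded functionals
  on the reproducing kernel Hilbert space, and their Riesz representers depend on \<open>x\<close> in a Lipschitz
  way: the squared distance of two of them is a mixed second difference of a second derivative of the
  kernel. The Hermite interpolant is an orthogonal projection of \<open>v\<close>, so the error \<open>v - s\<close> has norm
  at most that of \<open>v\<close>, and the gradient of the error is Lipschitz with a constant that does not depend
  on \<open>s\<close>.

  Every initial state in \<open>A\<close> is \<open>2 tol_d\<close>-close to a point of \<open>D\<close>, whose optimal trajectory (the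
  constant one, for the point \<open>0\<close>) stays in \<open>D\<close>. By Gronwall, each optimal trajectory therefore stays
  close to \<open>D\<close> on \<open>[0, T]\<close>, where the gradient error is at most \<open>tol_f\<close>. A second application of
  Gronwall compares the optimal with the surrogate trajectory; a continuity argument keeps the latter
  inside the tube. The point \<open>0\<close> lies in the reachable set because the optimal cost is finite and \<open>r\<close>
  is bounded away from zero on compact sets that avoid \<open>0\<close>.
\<close>

section \<open>Ordinary differential equations\<close>

text \<open>VKOGA controls the gradient error only on \<open>D\<close>, whereas the surrogate field
  is evaluated at points off \<open>D\<close>; a Lipschitz bound on that error, uniform over all
  interpolants, bridges the gap. The four derivatives of the kernel are spent in pairs: two form the
  inner products of the derivative representers, two more bound a mixed second difference of these
  inner products. Gradients are available only in the interior of the tube, and nothing is known of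
  the surrogate field outside it. Existence and uniqueness of the surrogate trajectory are therefore
  obtained together with the error estimate: the field is cut off to a globally Lipschitz one, and
  an a priori bound shows that the cut-off is never felt. The feedback is linear in the gradient, so
  a gradient error enters the field through a bounded matrix. The two Gronwall factors multiply in
  the coefficient of \<open>tol_d\<close>, while only the second one meets
  \<open>tol_f\<close>.\<close>

lemma gronwall_norm:
  fixes z z' :: "real \<Rightarrow> 'a::euclidean_space"
  assumes deriv: "\<And>t. t \<in> {0..T} \<Longrightarrow> (z has_vector_derivative z' t) (at t within {0..T})"
    and bound: "\<And>t. t \<in> {0..T} \<Longrightarrow> norm (z' t) \<le> L * norm (z t) + c"
    and "0 \<le> L" "0 \<le> c" "t \<in> {0..T}"
  shows "norm (z t) \<le> (norm (z 0) + c * t) * exp (L * t)"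
proof -
  \<comment> \<open>The norm is not differentiable at 0, so the estimate is proved for the smooth
    \<open>sqrt (z t \<bullet> z t + \<eta>)\<close>, and \<open>\<eta>\<close> tends to 0 at the
    end. Estimating \<open>exp (- L * s) * c\<close> by \<open>c\<close> costs sharpness but avoids
    a division by \<open>L\<close>, which may be 0.\<close>
  have perturbed: "exp (- L * t) * sqrt (z t \<bullet> z t + \<eta>) - c * t \<le> sqrt (z 0 \<bullet> z 0 + \<eta>)"
    if "\<eta> > 0" for \<eta> :: real
  proof -
    define \<phi> where "\<phi> s = sqrt (z s \<bullet> z s + \<eta>)" for s
    have pos: "0 < z s \<bullet> z s + \<eta>" for s
      using \<open>\<eta> > 0\<close> by (simp add: add_nonneg_pos)
    have phi_pos: "0 < \<phi> s" and norm_le: "norm (z s) \<le> \<phi> s" for s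
      using pos[of s] \<open>\<eta> > 0\<close> by (auto simp: \<phi>_def norm_eq_sqrt_inner)
    define \<psi> where "\<psi> s = exp (- L * s) * \<phi> s - c * s" for s
    define \<psi>' where "\<psi>' s = exp (- L * s) * (z s \<bullet> z' s / \<phi> s - L * \<phi> s) - c" for s
    have d: "(\<psi> has_vector_derivative \<psi>' s) (at s within {0..t})" if "s \<in> {0..t}" for s
    proof -
      have "(z has_vector_derivative z' s) (at s within {0..t})"
        using that assms(5) by (intro has_vector_derivative_within_subset[OF deriv]) auto
      then have zd: "(z has_derivative (\<lambda>h. h *\<^sub>R z' s)) (at s within {0..t})"
        by (simp add: has_vector_derivative_def)
      have "((\<lambda>s. z s \<bullet> z s + \<eta>) has_derivative (\<lambda>h. 2 * h * (z s \<bullet> z' s))) (at s within {0..t})"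
        by (rule derivative_eq_intros zd refl)+ (simp add: inner_commute algebra_simps)
      then have "((\<lambda>s. z s \<bullet> z s + \<eta>) has_real_derivative 2 * (z s \<bullet> z' s)) (at s within {0..t})"
        by (simp add: has_field_derivative_def mult_commute_abs mult_ac)
      then have "(\<phi> has_real_derivative (z s \<bullet> z' s / \<phi> s)) (at s within {0..t})"
        unfolding \<phi>_def
        by (rule DERIV_cong[OF DERIV_chain2[where f = sqrt and g = "\<lambda>s. z s \<bullet> z s + \<eta>", OF DERIV_real_sqrt[OF pos[of s]]]]) (simp add: field_simps)
      then have "(\<psi> has_real_derivative \<psi>' s) (at s within {0..t})"
        unfolding \<psi>_def \<psi>'_def by (auto intro!: derivative_eq_intros simp: algebra_simps)
      then show ?thesis
        by (simp add: has_real_derivative_iff_has_vector_derivative)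
    qed
    have nonpos: "\<psi>' s \<le> 0" if "s \<in> {0..t}" for s
    proof -
      have "z s \<bullet> z' s \<le> norm (z s) * norm (z' s)"
        by (rule norm_cauchy_schwarz)
      also have "\<dots> \<le> \<phi> s * (L * \<phi> s + c)"
      proof (rule mult_mono)
        have "norm (z' s) \<le> L * norm (z s) + c" using bound that assms(5) by auto
        also have "\<dots> \<le> L * \<phi> s + c" using norm_le assms(3) by (simp add: mult_left_mono)
        finally show "norm (z' s) \<le> L * \<phi> s + c" .
      qed (use norm_le phi_pos[of s] in auto)
      finally have "z s \<bullet> z' s / \<phi> s \<le> L * \<phi> s + c"
        using phi_pos[of s] by (simp add: pos_divide_le_eq mult.commute)
      then have "exp (- L * s) * (z s \<bullet> z' s / \<phi> s - L * \<phi> s) \<le> exp (- L * s) * c"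
        by (intro mult_left_mono) auto
      also have "\<dots> \<le> 1 * c"
        using that assms(3,4) by (intro mult_right_mono) auto
      finally show ?thesis by (simp add: \<psi>'_def)
    qed
    have "\<psi> t \<le> \<psi> 0"
    proof -
      have "(\<psi>' has_integral (\<psi> t - \<psi> 0)) {0..t}"
        using d assms(5) by (intro fundamental_theorem_of_calculus) auto
      from has_integral_le[OF this has_integral_const_real[of 0 0 t]] show ?thesis
        using nonpos by simp
    qed
    then show ?thesis by (simp add: \<psi>_def \<phi>_def)
  qed
  have "exp (- L * t) * sqrt (z t \<bullet> z t + 0) - c * t \<le> sqrt (z 0 \<bullet> z 0 + 0)"
  proof (rule tendsto_le)
    show "((\<lambda>\<eta>. sqrt (z 0 \<bullet> z 0 + \<eta>)) \<longlongrightarrow> sqrt (z 0 \<bullet> z 0 + 0)) (at_right 0)"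
      "((\<lambda>\<eta>. exp (- L * t) * sqrt (z t \<bullet> z t + \<eta>) - c * t)
         \<longlongrightarrow> exp (- L * t) * sqrt (z t \<bullet> z t + 0) - c * t) (at_right 0)"
      by (intro tendsto_intros)+
    show "\<forall>\<^sub>F \<eta> in at_right 0. exp (- L * t) * sqrt (z t \<bullet> z t + \<eta>) - c * t \<le> sqrt (z 0 \<bullet> z 0 + \<eta>)"
      by (rule eventually_at_right_less[THEN eventually_mono]) (use perturbed in auto)
  qed auto
  then have "exp (- L * t) * norm (z t) \<le> norm (z 0) + c * t"
    by (simp add: norm_eq_sqrt_inner)
  then show ?thesis
    by (simp add: exp_minus field_simps)
qed

text \<open>The gap \<open>B < B'\<close> drives this continuity argument: at the first time where
  \<open>u\<close> reaches \<open>B'\<close>, the weaker bound still holds up to and including that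
  time, so \<open>improve\<close> forces \<open>u\<close> down to \<open>B\<close>, a
  contradiction.\<close>

lemma bootstrap_le:
  fixes u :: "real \<Rightarrow> real"
  assumes cont: "continuous_on {0..T} u" and "u 0 \<le> B" "B < B'"
    and improve: "\<And>t. t \<in> {0..T} \<Longrightarrow> (\<And>s. s \<in> {0..t} \<Longrightarrow> u s \<le> B') \<Longrightarrow> u t \<le> B"
    and "t \<in> {0..T}"
  shows "u t \<le> B"
proof -
  have "u s \<le> B'" if "s \<in> {0..t}" for s
  proof (rule ccontr)
    assume "\<not> u s \<le> B'"
    define Z where "Z = {0..T} \<inter> u -` {B'..}"
    have "closed Z"
      unfolding Z_def by (intro continuous_closed_preimage cont) auto
    moreover have "Z \<subseteq> {0..T}" by (auto simp: Z_def)
    ultimately have "compact Z" by (meson bounded_closed_interval bounded_subset compact_eq_bounded_closed)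
    moreover have "s \<in> Z" using that assms(5) \<open>\<not> u s \<le> B'\<close> by (auto simp: Z_def)
    ultimately obtain m where m: "m \<in> Z" "\<And>z. z \<in> Z \<Longrightarrow> m \<le> z"
      using compact_attains_inf[of Z] by auto
    have "u 0 \<le> B'" "B' \<le> u m" "0 \<le> m" "m \<le> T"
      using m assms(2,3) by (auto simp: Z_def)
    moreover have "continuous_on {0..m} u"
      using continuous_on_subset[OF cont] \<open>m \<le> T\<close> by auto
    ultimately obtain m' where m': "0 \<le> m'" "m' \<le> m" "u m' = B'"
      using IVT'[of u 0 B' m] by auto
    then have "m' \<in> Z" using \<open>m \<le> T\<close> by (auto simp: Z_def)
    with m' m have "u m = B'" by (metis order_antisym)
    have "u m \<le> B"
    proof (rule improve)
      fix q assume "q \<in> {0..m}"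
      then show "u q \<le> B'"
        using m(2)[of q] \<open>u m = B'\<close> \<open>m \<le> T\<close> by (cases "q = m") (force simp: Z_def)+
    qed (use m in \<open>auto simp: Z_def\<close>)
    with \<open>u m = B'\<close> \<open>B < B'\<close> show False by simp
  qed
  then show ?thesis using improve assms(5) by blast
qed

lemma picard_lindeloef_global:
  fixes G :: "'a::euclidean_space \<Rightarrow> 'a"
  assumes lip: "L-lipschitz_on UNIV G" and "0 < T"
  obtains y where "y 0 = x0"
    "\<And>t. t \<in> {0..T} \<Longrightarrow> (y has_vector_derivative G (y t)) (at t within {0..T})"
proof -
  \<comment> \<open>The integral operator acts on \<open>w t = exp (- \<mu> t) y t\<close>: this weight makes it a contraction on all of \<open>[0, T]\<close>.\<close>
  define \<mu> where "\<mu> = 2 * L + 1"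
  have "L \<ge> 0" using lip by (rule lipschitz_on_nonneg)
  then have "\<mu> > 0" by (simp add: \<mu>_def)
  have contG: "continuous_on UNIV G" using lip by (rule lipschitz_on_continuous_on)
  \<comment> \<open>Clamping time to \<open>[0, T]\<close> turns candidate solutions into bounded
    continuous functions on the whole line, which form a complete space.\<close>
  define cl where "cl t = max 0 (min T t)" for t
  have cl: "cl t \<in> {0..T}" and cl_id: "t \<in> {0..T} \<Longrightarrow> cl t = t" for t
    using \<open>0 < T\<close> by (auto simp: cl_def)
  have cont_cl: "continuous_on UNIV cl"
    unfolding cl_def by (intro continuous_intros)
  define I where "I w t = integral {0..t} (\<lambda>s. G (exp (\<mu> * s) *\<^sub>R apply_bcontfun w s))" for w t
  define P where "P w t = exp (- \<mu> * cl t) *\<^sub>R (x0 + I w (cl t))" for w t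
  have cont_int: "continuous_on X (\<lambda>s. G (exp (\<mu> * s) *\<^sub>R apply_bcontfun w s))" for w X
    by (intro continuous_intros continuous_on_compose2[OF contG]) auto
  have int: "(\<lambda>s. G (exp (\<mu> * s) *\<^sub>R apply_bcontfun w s)) integrable_on {a..b}" for w a b
    by (intro integrable_continuous_interval cont_int)
  have contI: "continuous_on {0..T} (I w)" for w
    unfolding I_def by (rule indefinite_integral_continuous_1[OF int])
  have P_bcontfun: "P w \<in> bcontfun" for w
  proof -
    have "continuous_on UNIV (\<lambda>t. I w (cl t))"
      by (rule continuous_on_compose2[OF contI cont_cl]) (use cl in auto)
    then have cont: "continuous_on UNIV (P w)"
      unfolding P_def by (intro continuous_intros cont_cl)
    have "P w t \<in> P w ` {0..T}" for t
      using cl_id[OF cl] by (intro image_eqI[OF _ cl[of t]]) (simp add: P_def)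
    then have "range (P w) \<subseteq> P w ` {0..T}" by auto
    moreover have "compact (P w ` {0..T})"
      by (intro compact_continuous_image continuous_on_subset[OF cont]) auto
    ultimately have "bounded (range (P w))"
      using bounded_subset compact_imp_bounded by blast
    with cont show ?thesis by (simp add: bcontfun_def)
  qed
  define \<Phi> where "\<Phi> w = Bcontfun (P w)" for w
  have app: "apply_bcontfun (\<Phi> w) = P w" for w
    unfolding \<Phi>_def by (rule Bcontfun_inverse[OF P_bcontfun])
  have contract: "dist (\<Phi> w1) (\<Phi> w2) \<le> 1/2 * dist w1 w2" for w1 w2
  proof (rule dist_bound, unfold app)
    fix t
    let ?t = "cl t"
    have "norm (I w1 ?t - I w2 ?t) \<le> integral {0..?t} (\<lambda>s. L * dist w1 w2 * exp (\<mu> * s))"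
      unfolding I_def integral_diff[OF int int, symmetric]
    proof (rule integral_norm_bound_integral)
      show "(\<lambda>s. L * dist w1 w2 * exp (\<mu> * s)) integrable_on {0..?t}"
        by (intro integrable_continuous_interval continuous_intros)
      fix s
      have "norm (G (exp (\<mu> * s) *\<^sub>R w1 s) - G (exp (\<mu> * s) *\<^sub>R w2 s))
        \<le> L * norm (exp (\<mu> * s) *\<^sub>R w1 s - exp (\<mu> * s) *\<^sub>R w2 s)"
        using lipschitz_onD[OF lip, of "exp (\<mu> * s) *\<^sub>R w1 s" "exp (\<mu> * s) *\<^sub>R w2 s"]
        by (simp add: dist_norm)
      also have "\<dots> = L * (exp (\<mu> * s) * dist (w1 s) (w2 s))"
        by (simp add: dist_norm scaleR_right_diff_distrib[symmetric])
      also have "\<dots> \<le> L * (exp (\<mu> * s) * dist w1 w2)"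
        using \<open>L \<ge> 0\<close> by (intro mult_left_mono dist_bounded) auto
      finally show "norm (G (exp (\<mu> * s) *\<^sub>R w1 s) - G (exp (\<mu> * s) *\<^sub>R w2 s))
        \<le> L * dist w1 w2 * exp (\<mu> * s)" by (simp add: mult_ac)
    qed (intro integrable_diff int)
    also have "((\<lambda>s. L * dist w1 w2 * exp (\<mu> * s)) has_integral
        (L * dist w1 w2 * exp (\<mu> * ?t) / \<mu> - L * dist w1 w2 * exp (\<mu> * 0) / \<mu>)) {0..?t}"
      using \<open>\<mu> > 0\<close> cl[of t]
      by (intro fundamental_theorem_of_calculus)
        (auto intro!: derivative_eq_intros simp: has_real_derivative_iff_has_vector_derivative[symmetric])
    then have "integral {0..?t} (\<lambda>s. L * dist w1 w2 * exp (\<mu> * s))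
      = L * dist w1 w2 * exp (\<mu> * ?t) / \<mu> - L * dist w1 w2 * exp (\<mu> * 0) / \<mu>"
      by (rule integral_unique)
    also have "\<dots> \<le> L * dist w1 w2 * exp (\<mu> * ?t) / \<mu>"
      using \<open>\<mu> > 0\<close> \<open>L \<ge> 0\<close> by simp
    also have "\<dots> = (L / \<mu>) * (exp (\<mu> * ?t) * dist w1 w2)" by simp
    \<comment> \<open>\<open>\<mu> = 2 * L + 1\<close> was chosen for this: \<open>L / \<mu>\<close>
      is at most 1/2, and \<open>\<mu>\<close> is positive even for \<open>L = 0\<close>.\<close>
    also have "\<dots> \<le> 1/2 * (exp (\<mu> * ?t) * dist w1 w2)"
      using \<open>\<mu> > 0\<close> by (intro mult_right_mono) (auto simp: \<mu>_def field_simps)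
    finally have "norm (I w1 ?t - I w2 ?t) \<le> 1/2 * (exp (\<mu> * ?t) * dist w1 w2)" .
    then have "exp (- \<mu> * ?t) * norm (I w1 ?t - I w2 ?t)
       \<le> exp (- \<mu> * ?t) * (1/2 * (exp (\<mu> * ?t) * dist w1 w2))"
      by (intro mult_left_mono) auto
    also have "\<dots> = 1/2 * dist w1 w2"
      by (simp add: exp_minus)
    finally show "dist (P w1 t) (P w2 t) \<le> 1/2 * dist w1 w2"
      by (simp add: P_def dist_norm scaleR_right_diff_distrib[symmetric])
  qed
  obtain w where "\<Phi> w = w"
    using banach_fix_type[of "1/2" \<Phi>] contract by auto
  then have w: "apply_bcontfun w = P w" using app by metis
  define y where "y t = exp (\<mu> * t) *\<^sub>R w t" for t
  have y: "y t = x0 + integral {0..t} (\<lambda>s. G (y s))" if "t \<in> {0..T}" for t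
  proof -
    have "w t = exp (- \<mu> * t) *\<^sub>R (x0 + I w t)"
      using fun_cong[OF w, of t] that by (simp only: P_def cl_id)
    then have "y t = exp (\<mu> * t) *\<^sub>R exp (- \<mu> * t) *\<^sub>R (x0 + I w t)"
      by (simp only: y_def)
    then show ?thesis by (simp add: exp_minus I_def y_def)
  qed
  show thesis
  proof
    show "y 0 = x0" using y[of 0] \<open>0 < T\<close> by simp
    fix t assume t: "t \<in> {0..T}"
    have "((\<lambda>t. x0 + integral {0..t} (\<lambda>s. G (y s))) has_vector_derivative 0 + G (y t)) (at t within {0..T})"
      by (intro has_vector_derivative_add has_vector_derivative_const integral_has_vector_derivative t)
         (unfold y_def, rule cont_int)
    then have "((\<lambda>t. x0 + integral {0..t} (\<lambda>s. G (y s))) has_vector_derivative G (y t)) (at t within {0..T})"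
      by simp
    then show "(y has_vector_derivative G (y t)) (at t within {0..T})"
      by (rule has_vector_derivative_transform[OF t, where g = y, rotated]) (rule y)
  qed
qed

section \<open>Mixed second differences\<close>

lemma Cm_on_imp_continuous_on:
  assumes "Cm_on m U h" shows "continuous_on U h"
proof (cases m)
  case (Suc n)
  then obtain h' where "\<And>x. x \<in> U \<Longrightarrow> (h has_derivative h' x) (at x)"
    using assms by auto
  then show ?thesis
    by (meson continuous_at_imp_continuous_on has_derivative_continuous)
qed (use assms in simp)

lemma has_derivative_ray:
  fixes h :: "'a::real_normed_vector \<Rightarrow> real"
  assumes "(h has_derivative h') (at x)"
  shows "((\<lambda>t. h (x + t *\<^sub>R w)) has_real_derivative h' w) (at 0)"
proof -
  have "((\<lambda>t::real. x + t *\<^sub>R w) has_derivative (\<lambda>t. t *\<^sub>R w)) (at 0)"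
    by (auto intro!: derivative_eq_intros)
  from has_derivative_compose[OF this, of h h'] assms
  have "((\<lambda>t. h (x + t *\<^sub>R w)) has_derivative (\<lambda>t. h' (t *\<^sub>R w))) (at 0)" by simp
  then show ?thesis
    by (simp add: has_field_derivative_def linear_scale[OF has_derivative_linear[OF assms]] mult_commute_abs)
qed

text \<open>The mean value theorem is used twice: along the first slot for the difference of two
  edges of a rectangle, then along the second slot for \<open>\<phi>'\<close> in direction
  \<open>(a, 0)\<close>. Step sizes \<open>\<sigma>\<close>, \<open>\<tau>\<close> of either sign
  are kept apart from the directions, so that they can be divided out of a difference
  quotient.\<close>

lemma mixed_difference_mvt:
  fixes \<phi> :: "'a::euclidean_space \<times> 'a \<Rightarrow> real"
  assumes d1: "\<And>p. p \<in> U \<Longrightarrow> (\<phi> has_derivative \<phi>' p) (at p)"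
    and d2: "\<And>p. p \<in> U \<Longrightarrow> ((\<lambda>p. \<phi>' p (a, 0)) has_derivative \<phi>'' p) (at p)"
    and sub: "\<And>s t. s \<in> {0..1} \<Longrightarrow> t \<in> {0..1} \<Longrightarrow> (x + (s * \<sigma>) *\<^sub>R a, y + (t * \<tau>) *\<^sub>R b) \<in> U"
  shows "\<exists>s\<in>{0..1}. \<exists>t\<in>{0..1}.
    \<phi> (x + \<sigma> *\<^sub>R a, y + \<tau> *\<^sub>R b) - \<phi> (x + \<sigma> *\<^sub>R a, y) - \<phi> (x, y + \<tau> *\<^sub>R b) + \<phi> (x, y)
      = \<sigma> * \<tau> * \<phi>'' (x + (s * \<sigma>) *\<^sub>R a, y + (t * \<tau>) *\<^sub>R b) (0, b)"
proof -
  define P where "P s t = (x + (s * \<sigma>) *\<^sub>R a, y + (t * \<tau>) *\<^sub>R b)" for s t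
  have PU: "P s t \<in> U" if "s \<in> {0..1}" "t \<in> {0..1}" for s t
    using sub[OF that] by (simp add: P_def)
  have P1: "((\<lambda>s. \<phi> (P s t)) has_real_derivative \<sigma> * \<phi>' (P s t) (a, 0)) (at s)"
    if "s \<in> {0..1}" "t \<in> {0..1}" for s t
  proof -
    have "((\<lambda>s. P s t) has_derivative (\<lambda>h. (h * \<sigma>) *\<^sub>R (a, 0))) (at s)"
      unfolding P_def by (auto intro!: derivative_eq_intros)
    from has_derivative_compose[OF this d1[OF PU[OF that]]]
    have "((\<lambda>s. \<phi> (P s t)) has_derivative (\<lambda>h. \<phi>' (P s t) ((h * \<sigma>) *\<^sub>R (a, 0)))) (at s)" .
    moreover have "linear (\<phi>' (P s t))"
      using d1[OF PU[OF that]] by (rule has_derivative_linear)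
    ultimately show ?thesis
      by (simp only: linear_scale real_scaleR_def) (simp add: has_field_derivative_def mult_commute_abs mult_ac)
  qed
  have P2: "((\<lambda>t. \<phi>' (P s t) (a, 0)) has_real_derivative \<tau> * \<phi>'' (P s t) (0, b)) (at t)"
    if "s \<in> {0..1}" "t \<in> {0..1}" for s t
  proof -
    have "((\<lambda>t. P s t) has_derivative (\<lambda>h. (h * \<tau>) *\<^sub>R (0, b))) (at t)"
      unfolding P_def by (auto intro!: derivative_eq_intros)
    from has_derivative_compose[OF this d2[OF PU[OF that]]]
    have "((\<lambda>t. \<phi>' (P s t) (a, 0)) has_derivative (\<lambda>h. \<phi>'' (P s t) ((h * \<tau>) *\<^sub>R (0, b)))) (at t)" .
    moreover have "linear (\<phi>'' (P s t))"
      using d2[OF PU[OF that]] by (rule has_derivative_linear)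
    ultimately show ?thesis
      by (simp only: linear_scale real_scaleR_def) (simp add: has_field_derivative_def mult_commute_abs mult_ac)
  qed
  have "\<exists>s>0. s < 1 \<and> (\<phi> (P 1 1) - \<phi> (P 1 0)) - (\<phi> (P 0 1) - \<phi> (P 0 0))
      = (1 - 0) * (\<sigma> * \<phi>' (P s 1) (a, 0) - \<sigma> * \<phi>' (P s 0) (a, 0))"
    by (rule MVT2) (auto intro!: DERIV_diff P1)
  then obtain s where s: "0 < s" "s < 1"
    and seq: "(\<phi> (P 1 1) - \<phi> (P 1 0)) - (\<phi> (P 0 1) - \<phi> (P 0 0))
      = \<sigma> * (\<phi>' (P s 1) (a, 0) - \<phi>' (P s 0) (a, 0))"
    by (auto simp: right_diff_distrib)
  have "\<exists>t>0. t < 1 \<and> \<phi>' (P s 1) (a, 0) - \<phi>' (P s 0) (a, 0) = (1 - 0) * (\<tau> * \<phi>'' (P s t) (0, b))"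
    by (rule MVT2) (use s in \<open>auto intro!: P2\<close>)
  then obtain t where "0 < t" "t < 1"
    "\<phi>' (P s 1) (a, 0) - \<phi>' (P s 0) (a, 0) = \<tau> * \<phi>'' (P s t) (0, b)" by auto
  with s seq show ?thesis
    by (intro bexI[of _ s] bexI[of _ t]) (auto simp: P_def)
qed

text \<open>When \<open>K\<close> consists of the inner products of derivative representers, the
  left-hand side is the squared distance of two representers. Convexity keeps the rectangle spanned
  by \<open>x\<close> and \<open>y\<close> where \<open>K\<close> is smooth.\<close>

lemma mixed_difference_bound:
  fixes K :: "'a::euclidean_space \<times> 'a \<Rightarrow> real"
  assumes "open U" "Cm_on 2 U K" "compact C" "convex C" "C \<times> C \<subseteq> U"
  obtains M where "0 \<le> M"
    "\<And>x y. x \<in> C \<Longrightarrow> y \<in> C \<Longrightarrow> K (x, x) - K (x, y) - K (y, x) + K (y, y) \<le> M * (norm (x - y))\<^sup>2"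
proof -
  from assms(2) obtain K' where K': "\<And>p. p \<in> U \<Longrightarrow> (K has_derivative K' p) (at p)"
    and "\<forall>w. Cm_on 1 U (\<lambda>p. K' p w)"
    by (auto simp: numeral_2_eq_2)
  then have "\<forall>w. \<exists>h. (\<forall>p\<in>U. ((\<lambda>p. K' p w) has_derivative h p) (at p)) \<and>
      (\<forall>z. continuous_on U (\<lambda>p. h p z))"
    by simp
  then obtain K'' where K'': "\<And>w p. p \<in> U \<Longrightarrow> ((\<lambda>p. K' p w) has_derivative K'' w p) (at p)"
    and cont: "\<And>w z. continuous_on U (\<lambda>p. K'' w p z)"
    by metis
  have "\<exists>B. \<forall>p\<in>C \<times> C. norm (K'' (b, 0) p (0, c)) \<le> B" for b c
  proof -
    have "compact ((\<lambda>p. K'' (b, 0) p (0, c)) ` (C \<times> C))"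
      by (intro compact_continuous_image continuous_on_subset[OF cont] compact_Times assms)
    from compact_imp_bounded[OF this] show ?thesis by (auto simp: bounded_iff)
  qed
  then obtain B where B: "\<And>b c p. p \<in> C \<times> C \<Longrightarrow> norm (K'' (b, 0) p (0, c)) \<le> B b c" by metis
  \<comment> \<open>\<open>Cm_on\<close> yields continuity only for each fixed pair of directions,
    so \<open>M\<close> collects the bounds over pairs of basis vectors.\<close>
  define M where "M = (\<Sum>b\<in>Basis. \<Sum>c\<in>Basis. \<bar>B b c\<bar>)"
  show ?thesis
  proof
    show "0 \<le> M" by (simp add: M_def sum_nonneg)
    fix x y assume xy: "x \<in> C" "y \<in> C"
    define z where "z = y - x"
    have lin1: "linear (K' p)" if "p \<in> U" for p using has_derivative_linear[OF K'[OF that]] .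
    have lin2: "linear (K'' w p)" if "p \<in> U" for w p using has_derivative_linear[OF K''[OF that]] .
    have z1: "(z, 0) = (\<Sum>b\<in>Basis. (z \<bullet> b) *\<^sub>R (b, 0::'a))" and
         z2: "(0, z) = (\<Sum>b\<in>Basis. (z \<bullet> b) *\<^sub>R (0::'a, b))"
      by (auto simp: prod_eq_iff fst_sum snd_sum euclidean_representation)
    \<comment> \<open>The direction \<open>z\<close> varies with \<open>x\<close> and
      \<open>y\<close>; expanding in the basis reduces to the finitely many \<open>K''\<close> whose
      bounds enter \<open>M\<close>.\<close>
    have d2: "((\<lambda>p. K' p (z, 0)) has_derivative (\<lambda>h. \<Sum>b\<in>Basis. (z \<bullet> b) * K'' (b, 0) p h)) (at p)"
      if "p \<in> U" for p
    proof (rule has_derivative_transform_within_open[OF _ \<open>open U\<close> that])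
      show "((\<lambda>p. \<Sum>b\<in>Basis. (z \<bullet> b) * K' p (b, 0)) has_derivative
        (\<lambda>h. \<Sum>b\<in>Basis. (z \<bullet> b) * K'' (b, 0) p h)) (at p)"
        by (intro has_derivative_sum has_derivative_mult_right K'' that)
    next
      fix q assume "q \<in> U"
      then show "(\<Sum>b\<in>Basis. (z \<bullet> b) * K' q (b, 0)) = K' q (z, 0)"
        by (simp only: z1 linear_sum[OF lin1] linear_scale[OF lin1] real_scaleR_def)
    qed
    have conv: "x + (s * 1) *\<^sub>R z \<in> C" if "s \<in> {0..1}" for s
    proof -
      have "x + (s * 1) *\<^sub>R z = (1 - s) *\<^sub>R x + s *\<^sub>R y"
        by (simp add: z_def algebra_simps)
      then show ?thesis using convexD_alt[OF \<open>convex C\<close> xy, of s] that by simp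
    qed
    then have subU: "(x + (s * 1) *\<^sub>R z, x + (t * 1) *\<^sub>R z) \<in> U" if "s \<in> {0..1}" "t \<in> {0..1}" for s t
      using assms(5) that by blast
    obtain s t where st: "s \<in> {0..1}" "t \<in> {0..1}" and
      eq: "K (x + 1 *\<^sub>R z, x + 1 *\<^sub>R z) - K (x + 1 *\<^sub>R z, x) - K (x, x + 1 *\<^sub>R z) + K (x, x)
      = 1 * 1 * (\<Sum>b\<in>Basis. (z \<bullet> b) * K'' (b, 0) (x + (s * 1) *\<^sub>R z, x + (t * 1) *\<^sub>R z) (0, z))"
      using mixed_difference_mvt[OF K' d2 subU] by blast
    define p where "p = (x + (s * 1) *\<^sub>R z, x + (t * 1) *\<^sub>R z)"
    have p: "p \<in> C \<times> C" using conv st by (auto simp: p_def)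
    then have pU: "p \<in> U" using assms(5) by auto
    have "K (x, x) - K (x, y) - K (y, x) + K (y, y)
        = (\<Sum>b\<in>Basis. (z \<bullet> b) * K'' (b, 0) p (0, z))"
      using eq by (simp add: p_def z_def)
    also have "\<dots> = (\<Sum>b\<in>Basis. (z \<bullet> b) * (\<Sum>c\<in>Basis. (z \<bullet> c) * K'' (b, 0) p (0, c)))"
      by (simp only: z2 linear_sum[OF lin2[OF pU]] linear_scale[OF lin2[OF pU]] real_scaleR_def)
    also have "\<dots> = (\<Sum>b\<in>Basis. \<Sum>c\<in>Basis. (z \<bullet> b) * (z \<bullet> c) * K'' (b, 0) p (0, c))"
      by (simp add: sum_distrib_left mult_ac)
    also have "\<dots> \<le> (\<Sum>b\<in>Basis. \<Sum>c\<in>Basis. (norm z * norm z) * \<bar>B b c\<bar>)"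
    proof (intro sum_mono)
      fix b c :: 'a assume bc: "b \<in> Basis" "c \<in> Basis"
      have "(z \<bullet> b) * (z \<bullet> c) * K'' (b, 0) p (0, c) \<le> \<bar>z \<bullet> b\<bar> * \<bar>z \<bullet> c\<bar> * \<bar>K'' (b, 0) p (0, c)\<bar>"
        by (metis abs_ge_self abs_mult)
      also have "\<dots> \<le> (norm z * norm z) * \<bar>B b c\<bar>"
        using B[OF p, of b c] bc
        by (intro mult_mono Basis_le_norm) auto
      finally show "(z \<bullet> b) * (z \<bullet> c) * K'' (b, 0) p (0, c) \<le> (norm z * norm z) * \<bar>B b c\<bar>" .
    qed
    also have "\<dots> = M * (norm (x - y))\<^sup>2"
      by (simp add: M_def z_def sum_distrib_left sum_distrib_right power2_eq_square norm_minus_commute mult.commute)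
    finally show "K (x, x) - K (x, y) - K (y, x) + K (y, y) \<le> M * (norm (x - y))\<^sup>2" .
  qed
qed

section \<open>Reproducing kernel Hilbert spaces\<close>

text \<open>The Hilbert space is a set of functions with an explicit form \<open>ip\<close>, not a
  type with an inner product, so its elementary theory is derived from \<open>is_rkhs\<close>.
  Elements vanish off \<open>S\<close>, which makes equality on \<open>S\<close> equality of
  functions.\<close>

locale rkhs_space =
  fixes S :: "'a set" and k H ip
  assumes rkhs: "is_rkhs S k H ip"
begin

lemma outside: "h \<in> H \<Longrightarrow> x \<notin> S \<Longrightarrow> h x = 0"
  and H_zero: "(\<lambda>_. 0) \<in> H"
  and H_comb: "h1 \<in> H \<Longrightarrow> h2 \<in> H \<Longrightarrow> (\<lambda>x. a * h1 x + b * h2 x) \<in> H"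
  and ip_sym: "h1 \<in> H \<Longrightarrow> h2 \<in> H \<Longrightarrow> ip h1 h2 = ip h2 h1"
  and ip_comb: "h1 \<in> H \<Longrightarrow> h2 \<in> H \<Longrightarrow> h \<in> H \<Longrightarrow>
        ip (\<lambda>x. a * h1 x + b * h2 x) h = a * ip h1 h + b * ip h2 h"
  and ip_nonneg: "h \<in> H \<Longrightarrow> 0 \<le> ip h h"
  and kernel_in_H: "x \<in> S \<Longrightarrow> ext0 S (k x) \<in> H"
  and reproducing: "x \<in> S \<Longrightarrow> h \<in> H \<Longrightarrow> ip (ext0 S (k x)) h = h x"
  using rkhs unfolding is_rkhs_def by (elim conjE; simp)+

definition nrm :: "('a \<Rightarrow> real) \<Rightarrow> real" where "nrm h = sqrt (ip h h)"

lemma complete: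
  assumes "\<And>i::nat. F i \<in> H"
    and "\<And>e. e > 0 \<Longrightarrow> \<exists>n0. \<forall>i\<ge>n0. \<forall>j\<ge>n0. nrm (\<lambda>x. F i x - F j x) < e"
  shows "\<exists>h\<in>H. (\<lambda>i. nrm (\<lambda>x. F i x - h x)) \<longlonglongrightarrow> 0"
proof -
  have "\<forall>F :: nat \<Rightarrow> 'a \<Rightarrow> real.
        (\<forall>i. F i \<in> H) \<and>
        (\<forall>e>0. \<exists>n0. \<forall>i\<ge>n0. \<forall>j\<ge>n0.
           sqrt (ip (\<lambda>x. F i x - F j x) (\<lambda>x. F i x - F j x)) < e) \<longrightarrow>
        (\<exists>h\<in>H. (\<lambda>i. sqrt (ip (\<lambda>x. F i x - h x) (\<lambda>x. F i x - h x))) \<longlonglongrightarrow> 0)"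
    using rkhs unfolding is_rkhs_def by (elim conjE)
  then show ?thesis using assms unfolding nrm_def by (elim allE[of _ F]) simp
qed

lemma nrm_nonneg: "h \<in> H \<Longrightarrow> 0 \<le> nrm h"
  by (simp add: nrm_def ip_nonneg)

lemma nrm_square: "h \<in> H \<Longrightarrow> (nrm h)\<^sup>2 = ip h h"
  by (simp add: nrm_def ip_nonneg)

lemma H_diff: "h1 \<in> H \<Longrightarrow> h2 \<in> H \<Longrightarrow> (\<lambda>x. h1 x - h2 x) \<in> H"
  using H_comb[of h1 h2 1 "-1"] by simp

lemma ip_diff: "h1 \<in> H \<Longrightarrow> h2 \<in> H \<Longrightarrow> h \<in> H \<Longrightarrow> ip (\<lambda>x. h1 x - h2 x) h = ip h1 h - ip h2 h"
  using ip_comb[of h1 h2 h 1 "-1"] by simp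

lemma ip_diff_diff:
  assumes "h1 \<in> H" "h2 \<in> H"
  shows "ip (\<lambda>x. h1 x - h2 x) (\<lambda>x. h1 x - h2 x) = ip h1 h1 - 2 * ip h1 h2 + ip h2 h2"
proof -
  let ?d = "\<lambda>x. h1 x - h2 x"
  have "ip ?d ?d = ip h1 ?d - ip h2 ?d" using assms by (intro ip_diff H_diff)
  moreover have "ip h1 ?d = ip ?d h1" "ip h2 ?d = ip ?d h2" using assms by (auto intro: ip_sym H_diff)
  ultimately show ?thesis using assms by (simp add: ip_diff ip_sym[of h2 h1])
qed

lemma sum_in_H:
  assumes "finite I" "\<And>i. i \<in> I \<Longrightarrow> F i \<in> H"
  shows "(\<lambda>x. \<Sum>i\<in>I. c i * F i x) \<in> H"
  using assms
proof (induction I rule: finite_induct)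
  case (insert j I)
  then show ?case using H_comb[of "F j" "\<lambda>x. \<Sum>i\<in>I. c i * F i x" "c j" 1] by simp
qed (use H_zero in simp)

lemma ip_zero: "h \<in> H \<Longrightarrow> ip (\<lambda>_. 0) h = 0"
  using ip_comb[OF H_zero H_zero, of h 0 0] by simp

lemma ip_sum:
  assumes "finite I" "\<And>i. i \<in> I \<Longrightarrow> F i \<in> H" "h \<in> H"
  shows "ip (\<lambda>x. \<Sum>i\<in>I. c i * F i x) h = (\<Sum>i\<in>I. c i * ip (F i) h)"
  using assms
proof (induction I rule: finite_induct)
  case (insert j I)
  then show ?case
    using ip_comb[of "F j" "\<lambda>x. \<Sum>i\<in>I. c i * F i x" h "c j" 1] sum_in_H[of I F c] by simp
qed (simp add: ip_zero)

lemma cauchy_schwarz: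
  assumes "h1 \<in> H" "h2 \<in> H"
  shows "\<bar>ip h1 h2\<bar> \<le> nrm h1 * nrm h2"
proof -
  have quad: "0 \<le> a * a * ip h1 h1 + 2 * a * b * ip h1 h2 + b * b * ip h2 h2" for a b
  proof -
    let ?c = "\<lambda>x. a * h1 x + b * h2 x"
    have "?c \<in> H" using assms by (rule H_comb)
    then have "ip ?c ?c = a * ip ?c h1 + b * ip ?c h2"
      using assms by (simp add: ip_comb ip_sym[of h1 ?c] ip_sym[of h2 ?c])
    also have "\<dots> = a * a * ip h1 h1 + 2 * a * b * ip h1 h2 + b * b * ip h2 h2"
      using assms by (simp add: ip_comb ip_sym[of h2 h1] algebra_simps)
    finally show ?thesis using ip_nonneg[OF \<open>?c \<in> H\<close>] by simp
  qed
  have "(ip h1 h2)\<^sup>2 \<le> ip h1 h1 * ip h2 h2"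
  proof (cases "ip h2 h2 = 0")
    case True
    have "ip h1 h2 = 0"
    proof (rule ccontr)
      assume "ip h1 h2 \<noteq> 0"
      \<comment> \<open>With \<open>ip h2 h2 = 0\<close> the quadratic form is affine in
        \<open>b\<close>; this choice gives it the value -1.\<close>
      then show False
        using quad[of 1 "- (ip h1 h1 + 1) / (2 * ip h1 h2)"] True by (simp add: field_simps)
    qed
    then show ?thesis by (simp add: True)
  next
    case False
    then have "0 < ip h2 h2" using ip_nonneg assms by (simp add: less_le)
    have "0 \<le> ip h2 h2 * (ip h1 h1 * ip h2 h2 - (ip h1 h2)\<^sup>2)"
      using quad[of "ip h2 h2" "- ip h1 h2"] by (simp add: algebra_simps power2_eq_square)
    with \<open>0 < ip h2 h2\<close> show ?thesis by (simp add: zero_le_mult_iff)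
  qed
  then show ?thesis
    unfolding nrm_def real_sqrt_mult[symmetric] by (metis real_sqrt_abs real_sqrt_le_iff)
qed

lemma ip_tendsto:
  assumes "\<And>i. F i \<in> H" "d \<in> H" "h \<in> H" "(\<lambda>i. nrm (\<lambda>x. F i x - d x)) \<longlonglongrightarrow> 0"
  shows "(\<lambda>i. ip (F i) h) \<longlonglongrightarrow> ip d h"
proof -
  have "(\<lambda>i. ip (F i) h - ip d h) \<longlonglongrightarrow> 0"
  proof (rule Lim_null_comparison)
    show "\<forall>\<^sub>F i in sequentially. norm (ip (F i) h - ip d h) \<le> nrm (\<lambda>x. F i x - d x) * nrm h"
      using cauchy_schwarz[OF H_diff[OF assms(1) assms(2)] assms(3)] assms
      by (simp add: ip_diff)
    show "(\<lambda>i. nrm (\<lambda>x. F i x - d x) * nrm h) \<longlonglongrightarrow> 0"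
      using tendsto_mult_right[OF assms(4), of "nrm h"] by simp
  qed
  then show ?thesis by (simp add: LIM_zero_iff)
qed

end

section \<open>Directional derivatives as functionals on a smooth kernel space\<close>

text \<open>\<open>Cm_on\<close> only asserts that derivatives exist; here they are fixed as
  \<open>k'\<close> and \<open>k''\<close>. Only directions \<open>(w, 0)\<close> are differentiated
  again, since the representers come from the first slot. The C^2 condition on \<open>k''\<close>
  holds the two derivatives left for the Lipschitz bound. \<open>C\<close> is a convex superset, as
  a segment between points of \<open>S\<close> may leave \<open>S\<close>.\<close>

locale smooth_rkhs = rkhs_space S k H ip
  for S :: "'a::euclidean_space set" and k H ip +
  fixes C :: "'a set" and U :: "('a \<times> 'a) set" and k' :: "'a \<times> 'a \<Rightarrow> 'a \<times> 'a \<Rightarrow> real"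
    and k'' :: "'a \<Rightarrow> 'a \<times> 'a \<Rightarrow> 'a \<times> 'a \<Rightarrow> real"
  assumes open_U: "open U" and C: "compact C" "convex C" "S \<subseteq> C" "C \<times> C \<subseteq> U"
    and k': "\<And>p. p \<in> U \<Longrightarrow> ((\<lambda>(x, y). k x y) has_derivative k' p) (at p)"
    and k'': "\<And>w p. p \<in> U \<Longrightarrow> ((\<lambda>p. k' p (w, 0)) has_derivative k'' w p) (at p)"
    and k''_C2: "\<And>w z. Cm_on 2 U (\<lambda>p. k'' w p z)"
begin

text \<open>The Riesz representer of the derivative at \<open>x\<close> in direction \<open>w\<close>, and the difference quotients
  that converge to it.\<close>

definition kdiff :: "'a \<Rightarrow> 'a \<Rightarrow> 'a \<Rightarrow> real" where
  "kdiff w x = ext0 S (\<lambda>y. k' (x, y) (w, 0))"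

definition dquot :: "'a \<Rightarrow> 'a \<Rightarrow> real \<Rightarrow> 'a \<Rightarrow> real" where
  "dquot w x t = (\<lambda>y. (1 / t) * ext0 S (k (x + t *\<^sub>R w)) y + (- 1 / t) * ext0 S (k x) y)"

lemma in_U: "x \<in> S \<Longrightarrow> y \<in> S \<Longrightarrow> (x, y) \<in> U"
  using C by blast

lemma interior_ray:
  assumes "x \<in> interior S"
  obtains \<rho> where "\<rho> > 0" "\<And>t. \<bar>t\<bar> < \<rho> \<Longrightarrow> x + t *\<^sub>R w \<in> interior S"
proof -
  obtain e where e: "e > 0" "ball x e \<subseteq> interior S"
    using assms open_contains_ball open_interior by blast
  show ?thesis
  proof
    show "e / (norm w + 1) > 0" using e by (simp add: add_nonneg_pos)
    fix t assume "\<bar>t\<bar> < e / (norm w + 1)"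
    then have "\<bar>t\<bar> * (norm w + 1) < e"
      by (simp add: pos_less_divide_eq add_nonneg_pos)
    then have "\<bar>t\<bar> * norm w < e" by (simp add: algebra_simps)
    then show "x + t *\<^sub>R w \<in> interior S" using e(2) by (auto simp: dist_norm)
  qed
qed

lemma dquot_in_H:
  assumes "x \<in> S" "x + t *\<^sub>R w \<in> S" shows "dquot w x t \<in> H"
  unfolding dquot_def using assms by (intro H_comb kernel_in_H)

lemma ip_dquot:
  assumes "x \<in> S" "x + t *\<^sub>R w \<in> S" "h \<in> H"
  shows "ip (dquot w x t) h = (h (x + t *\<^sub>R w) - h x) / t"
  unfolding dquot_def using assms
  by (simp only: ip_comb kernel_in_H reproducing) (simp add: diff_divide_distrib)

text \<open>By the reproducing property the inner product of two difference quotients is a mixed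
  second difference of \<open>k\<close> over \<open>t' * t\<close>, which the mean value theorem
  turns into a value of \<open>k''\<close> near \<open>(x, x)\<close>. The joint limit in two
  independent parameters is what a Cauchy argument needs.\<close>

lemma ip_dquot_tendsto:
  assumes x: "x \<in> interior S" and "e > 0"
  shows "\<exists>\<rho>>0. (\<forall>t. \<bar>t\<bar> < \<rho> \<longrightarrow> x + t *\<^sub>R w \<in> S) \<and>
    (\<forall>t t'. 0 < \<bar>t\<bar> \<and> \<bar>t\<bar> < \<rho> \<and> 0 < \<bar>t'\<bar> \<and> \<bar>t'\<bar> < \<rho> \<longrightarrow>
       \<bar>ip (dquot w x t) (dquot w x t') - k'' w (x, x) (0, w)\<bar> < e)"
proof -
  obtain \<rho>1 where \<rho>1: "\<rho>1 > 0" "\<And>t. \<bar>t\<bar> < \<rho>1 \<Longrightarrow> x + t *\<^sub>R w \<in> interior S"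
    using interior_ray[OF x] by blast
  have xS: "x \<in> S" using x interior_subset by blast
  have "isCont (\<lambda>p. k'' w p (0, w)) (x, x)"
    using Cm_on_imp_continuous_on[OF k''_C2] in_U[OF xS xS] open_U
    by (simp add: continuous_on_eq_continuous_at)
  moreover have "isCont (\<lambda>q. (x + fst q *\<^sub>R w, x + snd q *\<^sub>R w)) (0::real, 0::real)"
    by (intro continuous_intros)
  ultimately have "isCont (\<lambda>q. k'' w (x + fst q *\<^sub>R w, x + snd q *\<^sub>R w) (0, w)) (0::real, 0::real)"
    using isCont_o2[of "(0, 0)" "\<lambda>q. (x + fst q *\<^sub>R w, x + snd q *\<^sub>R w)" "\<lambda>p. k'' w p (0, w)"] by simp
  then obtain d where d: "d > 0" "\<And>q. dist q (0, 0) < d \<Longrightarrow>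
      dist (k'' w (x + fst q *\<^sub>R w, x + snd q *\<^sub>R w) (0, w)) (k'' w (x, x) (0, w)) < e"
    using \<open>e > 0\<close> unfolding continuous_at_eps_delta by force
  define \<rho> where "\<rho> = min \<rho>1 (d / 2)"
  have ray: "x + t *\<^sub>R w \<in> S" if "\<bar>t\<bar> < \<rho>" for t
    using \<rho>1(2)[of t] that interior_subset by (auto simp: \<rho>_def)
  show ?thesis
  proof (intro exI[of _ \<rho>] conjI allI impI ray; (elim conjE)?)
    show "\<rho> > 0" using \<rho>1 d by (simp add: \<rho>_def)
    fix t t' :: real assume t: "0 < \<bar>t\<bar>" "\<bar>t\<bar> < \<rho>" "0 < \<bar>t'\<bar>" "\<bar>t'\<bar> < \<rho>"
    have shrink: "\<bar>s * r\<bar> < \<rho>" if "s \<in> {0..1}" "\<bar>r\<bar> < \<rho>" for s r :: real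
    proof -
      have "\<bar>s * r\<bar> \<le> 1 * \<bar>r\<bar>" unfolding abs_mult using that by (intro mult_right_mono) auto
      then show ?thesis using that by simp
    qed
    have "(x + (s * t') *\<^sub>R w, x + (s' * t) *\<^sub>R w) \<in> U" if "s \<in> {0..1}" "s' \<in> {0..1}" for s s'
      using shrink that t by (intro in_U ray) auto
    from mixed_difference_mvt[where \<phi> = "\<lambda>(x, y). k x y" and \<phi>'' = "k'' w", OF k' k'' this]
    obtain s s' where s: "s \<in> {0..1}" "s' \<in> {0..1}"
      and eq: "k (x + t' *\<^sub>R w) (x + t *\<^sub>R w) - k (x + t' *\<^sub>R w) x - k x (x + t *\<^sub>R w) + k x x
        = t' * t * k'' w (x + (s * t') *\<^sub>R w, x + (s' * t) *\<^sub>R w) (0, w)"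
      by auto
    have S: "x + t *\<^sub>R w \<in> S" "x + t' *\<^sub>R w \<in> S" using t by (auto intro: ray)
    have "ip (dquot w x t) (dquot w x t')
        = (dquot w x t' (x + t *\<^sub>R w) - dquot w x t' x) / t"
      using S xS by (intro ip_dquot dquot_in_H)
    also have "\<dots> = (k (x + t' *\<^sub>R w) (x + t *\<^sub>R w) - k (x + t' *\<^sub>R w) x - k x (x + t *\<^sub>R w) + k x x) / (t' * t)"
      using S xS t by (simp add: dquot_def ext0_def field_simps)
    also have "\<dots> = k'' w (x + (s * t') *\<^sub>R w, x + (s' * t) *\<^sub>R w) (0, w)"
      using t by (simp add: eq)
    finally have "ip (dquot w x t) (dquot w x t') = k'' w (x + (s * t') *\<^sub>R w, x + (s' * t) *\<^sub>R w) (0, w)" .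
    moreover have "dist (s * t', s' * t) (0, 0) < d"
    proof -
      have "dist (s * t', s' * t) (0, 0) \<le> \<bar>s * t'\<bar> + \<bar>s' * t\<bar>"
        using norm_Pair_le[of "s * t'" "s' * t"] by (simp add: dist_norm)
      also have "\<dots> < \<rho> + \<rho>" using shrink s t by (intro add_strict_mono) auto
      also have "\<dots> \<le> d" by (simp add: \<rho>_def)
      finally show ?thesis .
    qed
    ultimately show "\<bar>ip (dquot w x t) (dquot w x t') - k'' w (x, x) (0, w)\<bar> < e"
      using d(2)[of "(s * t', s' * t)"] by (simp add: dist_real_def)
  qed
qed

text \<open>The squared norm expands into three inner products with weights 1, -2, 1; each is within
  \<open>e\<^sup>2 / 4\<close> of the same limit, so the limits cancel and less than
  \<open>e\<^sup>2\<close> remains.\<close>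

lemma dquot_cauchy:
  assumes x: "x \<in> interior S" and "e > 0"
  shows "\<exists>\<rho>>0. (\<forall>t. \<bar>t\<bar> < \<rho> \<longrightarrow> x + t *\<^sub>R w \<in> S) \<and>
    (\<forall>t t'. 0 < \<bar>t\<bar> \<and> \<bar>t\<bar> < \<rho> \<and> 0 < \<bar>t'\<bar> \<and> \<bar>t'\<bar> < \<rho> \<longrightarrow>
       nrm (\<lambda>y. dquot w x t y - dquot w x t' y) < e)"
proof -
  have "e\<^sup>2 / 4 > 0" using \<open>e > 0\<close> by simp
  then obtain \<rho> where \<rho>: "\<rho> > 0" "\<And>t. \<bar>t\<bar> < \<rho> \<Longrightarrow> x + t *\<^sub>R w \<in> S"
    "\<And>t t'. 0 < \<bar>t\<bar> \<and> \<bar>t\<bar> < \<rho> \<and> 0 < \<bar>t'\<bar> \<and> \<bar>t'\<bar> < \<rho> \<Longrightarrow>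
       \<bar>ip (dquot w x t) (dquot w x t') - k'' w (x, x) (0, w)\<bar> < e\<^sup>2 / 4"
    using ip_dquot_tendsto[OF x, of "e\<^sup>2 / 4" w] by blast
  have xS: "x \<in> S" using x interior_subset by blast
  show ?thesis
  proof (intro exI[of _ \<rho>] conjI allI impI \<rho>(1,2); (elim conjE)?)
    fix t t' :: real assume t: "0 < \<bar>t\<bar>" "\<bar>t\<bar> < \<rho>" "0 < \<bar>t'\<bar>" "\<bar>t'\<bar> < \<rho>"
    have q: "dquot w x t \<in> H" "dquot w x t' \<in> H"
      using t xS \<rho>(2) by (auto intro: dquot_in_H)
    have "ip (\<lambda>y. dquot w x t y - dquot w x t' y) (\<lambda>y. dquot w x t y - dquot w x t' y) < e\<^sup>2"
      using \<rho>(3)[of t t] \<rho>(3)[of t t'] \<rho>(3)[of t' t'] t unfolding ip_diff_diff[OF q] by linarith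
    then show "nrm (\<lambda>y. dquot w x t y - dquot w x t' y) < e"
      unfolding nrm_def using \<open>e > 0\<close> by (metis abs_of_pos real_sqrt_abs real_sqrt_less_iff)
  qed
qed

lemma kernel_derivative_fst:
  assumes "(x, y) \<in> U"
  shows "((\<lambda>z. k z y) has_derivative (\<lambda>w. k' (x, y) (w, 0))) (at x)"
proof -
  have "((\<lambda>z. (z, y)) has_derivative (\<lambda>w. (w, 0))) (at x)"
    by (auto intro!: derivative_eq_intros)
  from has_derivative_compose[OF this k'[OF assms]] show ?thesis by simp
qed

text \<open>Completeness provides a limit of the difference quotients in \<open>H\<close>. Testing
  it against kernels identifies it as \<open>kdiff w x\<close>, and continuity of the inner product
  gives the derivative of every \<open>h\<close>.\<close>

lemma kdiff_in_H_and_derivative: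
  assumes x: "x \<in> interior S"
  shows "kdiff w x \<in> H"
    and "h \<in> H \<Longrightarrow> ((\<lambda>t. h (x + t *\<^sub>R w)) has_real_derivative ip (kdiff w x) h) (at 0)"
proof -
  have xS: "x \<in> S" using x interior_subset by blast
  obtain \<rho>0 where \<rho>0: "\<rho>0 > 0" "\<And>t. \<bar>t\<bar> < \<rho>0 \<Longrightarrow> x + t *\<^sub>R w \<in> S"
    using dquot_cauchy[OF x zero_less_one, of w] by blast
  \<comment> \<open>The offset 2 makes \<open>\<tau> i < \<rho>0\<close> strict already at
    \<open>i = 0\<close>.\<close>
  define \<tau> where "\<tau> i = \<rho>0 / real (i + 2)" for i :: nat
  have \<tau>: "0 < \<tau> i" "\<bar>\<tau> i\<bar> < \<rho>0" for i
    using \<rho>0(1) by (auto simp: \<tau>_def divide_less_eq algebra_simps add_strict_increasing)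
  have \<tau>_lim: "\<tau> \<longlonglongrightarrow> 0"
    unfolding \<tau>_def using LIMSEQ_ignore_initial_segment[OF lim_const_over_n[of \<rho>0], of 2] by simp
  have \<tau>_small: "\<forall>\<^sub>F i in sequentially. \<bar>\<tau> i\<bar> < e" if "e > 0" for e
    using order_tendstoD(2)[OF tendsto_rabs[OF \<tau>_lim], of e] that by simp
  define F where "F i = dquot w x (\<tau> i)" for i
  have F_H: "F i \<in> H" for i
    unfolding F_def using \<tau> xS \<rho>0(2) by (intro dquot_in_H) auto
  have "\<exists>h\<in>H. (\<lambda>i. nrm (\<lambda>x. F i x - h x)) \<longlonglongrightarrow> 0"
  proof (rule complete[OF F_H])
    fix e :: real assume "e > 0"
    obtain \<rho> where \<rho>: "\<rho> > 0" "\<And>t t'. 0 < \<bar>t\<bar> \<and> \<bar>t\<bar> < \<rho> \<and> 0 < \<bar>t'\<bar> \<and> \<bar>t'\<bar> < \<rho> \<Longrightarrow>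
       nrm (\<lambda>y. dquot w x t y - dquot w x t' y) < e"
      using dquot_cauchy[OF x \<open>e > 0\<close>, of w] by blast
    from \<tau>_small[OF \<rho>(1)] obtain n0 where "\<forall>i\<ge>n0. \<bar>\<tau> i\<bar> < \<rho>"
      by (auto simp: eventually_sequentially)
    then show "\<exists>n0. \<forall>i\<ge>n0. \<forall>j\<ge>n0. nrm (\<lambda>x. F i x - F j x) < e"
      unfolding F_def using \<tau>(1) by (intro exI[of _ n0] allI impI \<rho>(2)) (auto simp: less_imp_neq[symmetric])
  qed
  then obtain d where d: "d \<in> H" "(\<lambda>i. nrm (\<lambda>x. F i x - d x)) \<longlonglongrightarrow> 0" by blast
  have lim: "(\<lambda>i. ip (F i) h) \<longlonglongrightarrow> ip d h" if "h \<in> H" for h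
    by (rule ip_tendsto[OF F_H d(1) that d(2)])
  have "d y = kdiff w x y" for y
  proof (cases "y \<in> S")
    case True
    have "((\<lambda>t. k (x + t *\<^sub>R w) y) has_real_derivative k' (x, y) (w, 0)) (at 0)"
      using has_derivative_ray[OF kernel_derivative_fst[OF in_U[OF xS True]]] by simp
    then have "((\<lambda>t. (k (x + t *\<^sub>R w) y - k x y) / t) \<longlongrightarrow> k' (x, y) (w, 0)) (at 0)"
      by (simp add: DERIV_def)
    moreover have "filterlim \<tau> (at 0) sequentially"
      using \<tau>_lim \<tau>(1) by (intro filterlim_atI) (auto simp: less_imp_neq[symmetric])
    ultimately have "((\<lambda>i. (k (x + \<tau> i *\<^sub>R w) y - k x y) / \<tau> i) \<longlongrightarrow> k' (x, y) (w, 0)) sequentially"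
      by (rule filterlim_compose)
    moreover have "ip (F i) (ext0 S (k y)) = (k (x + \<tau> i *\<^sub>R w) y - k x y) / \<tau> i" for i
      using reproducing[OF True F_H, of i] True F_H[of i] kernel_in_H[OF True]
      by (subst ip_sym) (auto simp: F_def dquot_def ext0_def diff_divide_distrib)
    ultimately have "ip d (ext0 S (k y)) = k' (x, y) (w, 0)"
      using lim[OF kernel_in_H[OF True]] by (simp add: LIMSEQ_unique)
    then show ?thesis
      using reproducing[OF True d(1)] ip_sym[OF d(1) kernel_in_H[OF True]] True
      by (simp add: kdiff_def ext0_def)
  qed (use outside d in \<open>auto simp: kdiff_def ext0_def\<close>)
  then have kd: "kdiff w x = d" by auto
  with d show "kdiff w x \<in> H" by simp
  assume h: "h \<in> H"
  \<comment> \<open>The limit is needed for all small \<open>t\<close>, not only along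
    \<open>\<tau>\<close>: the quotient at \<open>t\<close> is compared with \<open>F i\<close>, and
    \<open>i\<close> tends to infinity in a bound that does not depend on \<open>i\<close>.\<close>
  have "((\<lambda>t. (h (x + t *\<^sub>R w) - h x) / t) \<longlongrightarrow> ip d h) (at 0)"
  proof (rule LIM_I)
    fix e :: real assume "e > 0"
    define e' where "e' = e / (2 * (nrm h + 1))"
    have "nrm h + 1 > 0" using nrm_nonneg[OF h] by simp
    then have "e' > 0" using \<open>e > 0\<close> by (simp add: e'_def)
    then obtain \<rho> where \<rho>: "\<rho> > 0" "\<And>t. \<bar>t\<bar> < \<rho> \<Longrightarrow> x + t *\<^sub>R w \<in> S"
      "\<And>t t'. 0 < \<bar>t\<bar> \<and> \<bar>t\<bar> < \<rho> \<and> 0 < \<bar>t'\<bar> \<and> \<bar>t'\<bar> < \<rho> \<Longrightarrow>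
       nrm (\<lambda>y. dquot w x t y - dquot w x t' y) < e'"
      using dquot_cauchy[OF x \<open>e' > 0\<close>, of w] by blast
    show "\<exists>\<rho>>0. \<forall>t. t \<noteq> 0 \<and> norm (t - 0) < \<rho> \<longrightarrow> norm ((h (x + t *\<^sub>R w) - h x) / t - ip d h) < e"
    proof (intro exI conjI allI impI)
      fix t :: real assume t: "t \<noteq> 0 \<and> norm (t - 0) < \<rho>"
      have q: "dquot w x t \<in> H" using t \<rho>(2) xS by (intro dquot_in_H) auto
      have "\<forall>\<^sub>F i in sequentially. \<bar>ip (dquot w x t) h - ip (F i) h\<bar> \<le> e' * nrm h"
        using \<tau>_small[OF \<rho>(1)]
      proof eventually_elim
        case (elim i)
        have "\<bar>ip (dquot w x t) h - ip (F i) h\<bar> \<le> nrm (\<lambda>y. dquot w x t y - F i y) * nrm h"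
          using cauchy_schwarz[OF H_diff[OF q F_H] h] ip_diff[OF q F_H h] by simp
        also have "\<dots> \<le> e' * nrm h"
          unfolding F_def using t elim \<tau>(1)[of i] nrm_nonneg[OF h]
          by (intro mult_right_mono less_imp_le[OF \<rho>(3)]) auto
        finally show ?case .
      qed
      moreover have "(\<lambda>i. \<bar>ip (dquot w x t) h - ip (F i) h\<bar>) \<longlonglongrightarrow> \<bar>ip (dquot w x t) h - ip d h\<bar>"
        by (intro tendsto_intros lim h)
      ultimately have "\<bar>ip (dquot w x t) h - ip d h\<bar> \<le> e' * nrm h"
        by (intro tendsto_upperbound) auto
      also have "\<dots> < e"
        using \<open>nrm h + 1 > 0\<close> \<open>e > 0\<close> nrm_nonneg[OF h] by (simp add: e'_def field_simps add_strict_increasing)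
      finally show "norm ((h (x + t *\<^sub>R w) - h x) / t - ip d h) < e"
        using ip_dquot[OF xS _ h, of t w] \<rho>(2) t by simp
    qed (use \<rho> in auto)
  qed
  then show "((\<lambda>t. h (x + t *\<^sub>R w)) has_real_derivative ip (kdiff w x) h) (at 0)"
    by (simp add: DERIV_def kd)
qed

lemmas kdiff_in_H = kdiff_in_H_and_derivative(1)
  and kdiff_derivative = kdiff_in_H_and_derivative(2)

text \<open>The representer \<open>kdiff w y\<close> is itself an element of \<open>H\<close>. Its
  derivative at \<open>x\<close> is computed once by the representer property and once from its
  formula through \<open>k'\<close>; uniqueness of derivatives equates the two.\<close>

lemma ip_kdiff_kdiff:
  assumes x: "x \<in> interior S" and y: "y \<in> interior S"
  shows "ip (kdiff w x) (kdiff w y) = k'' w (y, x) (0, w)"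
proof -
  have S: "x \<in> S" "y \<in> S" using x y interior_subset by blast+
  have d: "((\<lambda>t. kdiff w y (x + t *\<^sub>R w)) has_real_derivative ip (kdiff w x) (kdiff w y)) (at 0)"
    by (intro kdiff_derivative kdiff_in_H x y)
  obtain \<rho> where \<rho>: "\<rho> > 0" "\<And>t. \<bar>t\<bar> < \<rho> \<Longrightarrow> x + t *\<^sub>R w \<in> interior S"
    using interior_ray[OF x] by blast
  have "((\<lambda>z. (y, z)) has_derivative (\<lambda>z. (0, z))) (at x)"
    by (auto intro!: derivative_eq_intros)
  from has_derivative_compose[OF this k''[OF in_U[OF S(2,1)]]]
  have "((\<lambda>z. k' (y, z) (w, 0)) has_derivative (\<lambda>z. k'' w (y, x) (0, z))) (at x)" .
  from has_derivative_ray[OF this]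
  have "((\<lambda>t. k' (y, x + t *\<^sub>R w) (w, 0)) has_real_derivative k'' w (y, x) (0, w)) (at 0)" .
  then have "((\<lambda>t. kdiff w y (x + t *\<^sub>R w)) has_real_derivative k'' w (y, x) (0, w)) (at 0)"
    by (rule has_field_derivative_transform_within[OF _ \<rho>(1)])
      (use \<rho>(2) interior_subset in \<open>force simp: kdiff_def ext0_def dist_real_def\<close>)+
  from DERIV_unique[OF d this] show ?thesis .
qed

lemma kdiff_lipschitz:
  "\<exists>M\<ge>0. \<forall>x\<in>interior S. \<forall>y\<in>interior S.
     nrm (\<lambda>z. kdiff w x z - kdiff w y z) \<le> M * norm (x - y)"
proof -
  obtain B where B: "0 \<le> B" "\<And>x y. x \<in> C \<Longrightarrow> y \<in> C \<Longrightarrow>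
      k'' w (x, x) (0, w) - k'' w (x, y) (0, w) - k'' w (y, x) (0, w) + k'' w (y, y) (0, w)
        \<le> B * (norm (x - y))\<^sup>2"
    using mixed_difference_bound[OF open_U k''_C2 C(1,2,4), of w "(0, w)"] by blast
  show ?thesis
  proof (intro exI[of _ "sqrt B"] conjI ballI)
    show "0 \<le> sqrt B" using B by simp
    fix x y assume x: "x \<in> interior S" and y: "y \<in> interior S"
    have "x \<in> C" "y \<in> C" using x y C(3) interior_subset by blast+
    note bd = B(2)[OF this]
    have "ip (kdiff w x) (kdiff w y) = ip (kdiff w y) (kdiff w x)"
      by (intro ip_sym kdiff_in_H x y)
    then have "ip (\<lambda>z. kdiff w x z - kdiff w y z) (\<lambda>z. kdiff w x z - kdiff w y z)
        \<le> B * (norm (x - y))\<^sup>2"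
      using bd x y by (simp add: ip_diff_diff kdiff_in_H ip_kdiff_kdiff)
    then show "nrm (\<lambda>z. kdiff w x z - kdiff w y z) \<le> sqrt B * norm (x - y)"
      unfolding nrm_def
      by (metis (no_types) abs_norm_cancel real_sqrt_abs real_sqrt_le_mono real_sqrt_mult)
  qed
qed

lemma kdiff_eq_sum:
  assumes "x \<in> S"
  shows "kdiff w x = (\<lambda>y. \<Sum>b\<in>Basis. (w \<bullet> b) * kdiff b x y)"
proof
  fix y show "kdiff w x y = (\<Sum>b\<in>Basis. (w \<bullet> b) * kdiff b x y)"
  proof (cases "y \<in> S")
    case True
    have w: "(w, 0) = (\<Sum>b\<in>Basis. (w \<bullet> b) *\<^sub>R (b, 0::'a))"
      by (auto simp: prod_eq_iff fst_sum snd_sum euclidean_representation)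
    have "linear (k' (x, y))" by (rule has_derivative_linear[OF k'[OF in_U[OF assms True]]])
    then show ?thesis
      using True by (simp only: kdiff_def ext0_def if_True w linear_sum linear_scale real_scaleR_def)
  qed (simp add: kdiff_def ext0_def)
qed

text \<open>A candidate assembled from directional derivatives; that it is the Frechet gradient
  needs its continuity and is shown in \<open>GDERIV_gradH\<close>.\<close>

definition gradH :: "('a \<Rightarrow> real) \<Rightarrow> 'a \<Rightarrow> 'a" where
  "gradH h x = (\<Sum>b\<in>Basis. ip (kdiff b x) h *\<^sub>R b)"

lemma ip_kdiff:
  assumes "x \<in> interior S" "h \<in> H"
  shows "ip (kdiff w x) h = w \<bullet> gradH h x"
proof -
  have "x \<in> S" using assms interior_subset by blast
  then show ?thesis
    using assms by (subst kdiff_eq_sum) (auto simp: ip_sum kdiff_in_H gradH_def inner_sum_right mult.commute)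
qed

text \<open>The dependence on \<open>h\<close> is confined to the factor \<open>nrm h\<close>. This
  makes the constant uniform over all interpolants once their errors are bounded in norm.\<close>

lemma gradH_lipschitz:
  obtains M where "0 < M"
    "\<And>h x y. h \<in> H \<Longrightarrow> x \<in> interior S \<Longrightarrow> y \<in> interior S \<Longrightarrow>
       norm (gradH h x - gradH h y) \<le> M * nrm h * norm (x - y)"
proof -
  obtain M where M: "\<And>w. 0 \<le> M w" "\<And>w x y. x \<in> interior S \<Longrightarrow> y \<in> interior S \<Longrightarrow>
       nrm (\<lambda>z. kdiff w x z - kdiff w y z) \<le> M w * norm (x - y)"
    using kdiff_lipschitz by metis
  show ?thesis
  proof
    show "0 < (\<Sum>b\<in>Basis. M b) + 1" using M(1) by (simp add: sum_nonneg add_nonneg_pos)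
    fix h x y assume h: "h \<in> H" and x: "x \<in> interior S" and y: "y \<in> interior S"
    have "gradH h x - gradH h y = (\<Sum>b\<in>Basis. (ip (kdiff b x) h - ip (kdiff b y) h) *\<^sub>R b)"
      by (simp add: gradH_def sum_subtractf scaleR_left_diff_distrib)
    also have "norm \<dots> \<le> (\<Sum>b\<in>Basis. \<bar>ip (kdiff b x) h - ip (kdiff b y) h\<bar>)"
      by (rule order.trans[OF norm_sum]) (auto intro!: sum_mono)
    also have "\<dots> \<le> (\<Sum>b\<in>Basis. M b * norm (x - y) * nrm h)"
    proof (rule sum_mono)
      fix b :: 'a
      have "\<bar>ip (kdiff b x) h - ip (kdiff b y) h\<bar> \<le> nrm (\<lambda>z. kdiff b x z - kdiff b y z) * nrm h"
        using cauchy_schwarz[of "\<lambda>z. kdiff b x z - kdiff b y z" h] h x y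
        by (simp add: ip_diff kdiff_in_H H_diff)
      also have "\<dots> \<le> M b * norm (x - y) * nrm h"
        by (intro mult_right_mono M x y nrm_nonneg h)
      finally show "\<bar>ip (kdiff b x) h - ip (kdiff b y) h\<bar> \<le> M b * norm (x - y) * nrm h" .
    qed
    also have "\<dots> = (\<Sum>b\<in>Basis. M b) * (nrm h * norm (x - y))"
      by (simp add: sum_distrib_right mult_ac)
    also have "\<dots> \<le> ((\<Sum>b\<in>Basis. M b) + 1) * (nrm h * norm (x - y))"
      using nrm_nonneg[OF h] by (intro mult_right_mono) auto
    finally show "norm (gradH h x - gradH h y) \<le> ((\<Sum>b\<in>Basis. M b) + 1) * nrm h * norm (x - y)"
      by (simp add: mult_ac)
  qed
qed

text \<open>Directional derivatives alone do not give differentiability; the Lipschitz bound on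
  \<open>gradH\<close> along the segment, combined with the mean value theorem, does.\<close>

lemma GDERIV_gradH:
  assumes h: "h \<in> H" and x: "x \<in> interior S"
  shows "GDERIV h x :> gradH h x"
  unfolding gderiv_def has_derivative_at_alt
proof (intro conjI allI impI)
  show "bounded_linear (\<lambda>z. z \<bullet> gradH h x)" by (rule bounded_linear_inner_left)
  fix e :: real assume "e > 0"
  obtain M where M: "0 < M" "\<And>h x y. h \<in> H \<Longrightarrow> x \<in> interior S \<Longrightarrow> y \<in> interior S \<Longrightarrow>
       norm (gradH h x - gradH h y) \<le> M * nrm h * norm (x - y)"
    using gradH_lipschitz by blast
  define L where "L = M * nrm h + 1"
  have "L > 0" using M(1) nrm_nonneg[OF h] by (simp add: L_def add_nonneg_pos)
  obtain r where r: "r > 0" "ball x r \<subseteq> interior S"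
    using x open_contains_ball open_interior by blast
  show "\<exists>d>0. \<forall>y. norm (y - x) < d \<longrightarrow>
      norm (h y - h x - (y - x) \<bullet> gradH h x) \<le> e * norm (y - x)"
  proof (intro exI conjI allI impI)
    \<comment> \<open>\<open>r\<close> keeps the segment in the interior, and \<open>e / L\<close>
      makes the variation of the gradient along it at most \<open>e\<close>.\<close>
    show "min r (e / L) > 0" using r \<open>e > 0\<close> \<open>L > 0\<close> by simp
    fix y assume y: "norm (y - x) < min r (e / L)"
    define z where "z = y - x"
    have path: "x + t *\<^sub>R z \<in> interior S" if "t \<in> {0..1}" for t
    proof -
      have "norm (t *\<^sub>R z) \<le> 1 * norm z" unfolding norm_scaleR using that by (intro mult_right_mono) auto
      then show ?thesis using y r(2) by (auto simp: z_def dist_norm)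
    qed
    have deriv: "((\<lambda>t. h (x + t *\<^sub>R z)) has_real_derivative z \<bullet> gradH h (x + t *\<^sub>R z)) (at t)"
      if "t \<in> {0..1}" for t
    proof -
      have "((\<lambda>s. h (x + t *\<^sub>R z + s *\<^sub>R z)) has_real_derivative z \<bullet> gradH h (x + t *\<^sub>R z)) (at 0)"
        using kdiff_derivative[OF path[OF that] h, of z] ip_kdiff[OF path[OF that] h] by simp
      then have "((\<lambda>s. h (x + (s + t) *\<^sub>R z)) has_real_derivative z \<bullet> gradH h (x + t *\<^sub>R z)) (at 0)"
        by (simp add: algebra_simps)
      then show ?thesis
        using DERIV_shift[of "\<lambda>s. h (x + s *\<^sub>R z)" _ 0 t] by simp
    qed
    have "\<exists>t>0. t < 1 \<and> h (x + 1 *\<^sub>R z) - h (x + 0 *\<^sub>R z) = (1 - 0) * (z \<bullet> gradH h (x + t *\<^sub>R z))"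
      by (rule MVT2) (auto intro!: deriv)
    then obtain t where t: "0 < t" "t < 1" and eq: "h y - h x = z \<bullet> gradH h (x + t *\<^sub>R z)"
      by (auto simp: z_def)
    have "norm (h y - h x - (y - x) \<bullet> gradH h x) = \<bar>z \<bullet> (gradH h (x + t *\<^sub>R z) - gradH h x)\<bar>"
      by (simp add: eq inner_diff_right z_def[symmetric])
    also have "\<dots> \<le> norm z * norm (gradH h (x + t *\<^sub>R z) - gradH h x)"
      by (rule Cauchy_Schwarz_ineq2)
    also have "\<dots> \<le> norm z * (L * norm z)"
    proof (rule mult_left_mono)
      have "norm (gradH h (x + t *\<^sub>R z) - gradH h x) \<le> M * nrm h * norm (x + t *\<^sub>R z - x)"
        using t by (intro M h path x) auto
      also have "\<dots> \<le> L * norm z"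
        unfolding L_def using t M(1) nrm_nonneg[OF h] by (intro mult_mono) (auto intro: mult_left_le_one_le)
      finally show "norm (gradH h (x + t *\<^sub>R z) - gradH h x) \<le> L * norm z" .
    qed simp
    also have "\<dots> \<le> norm z * e"
      using y \<open>L > 0\<close> by (intro mult_left_mono) (auto simp: z_def field_simps)
    finally show "norm (h y - h x - (y - x) \<bullet> gradH h x) \<le> e * norm (y - x)"
      by (simp add: z_def mult.commute)
  qed
qed

end

section \<open>Hermite interpolation\<close>

lemma GDERIV_imp_grad:
  assumes "GDERIV h x :> d" shows "grad h x = d"
  unfolding grad_def
proof (rule the_equality)
  fix d' assume "GDERIV h x :> d'"
  with assms have "(\<lambda>z. z \<bullet> d') = (\<lambda>z. z \<bullet> d)"
    unfolding gderiv_def by (rule has_derivative_unique[rotated])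
  then show "d' = d" by (metis inner_commute vector_eq_rdot)
qed (rule assms)

lemma has_derivative_inner_grad:
  fixes h :: "'a::euclidean_space \<Rightarrow> real"
  assumes "(h has_derivative h') (at x)"
  shows "w \<bullet> grad h x = h' w"
proof -
  have lin: "linear h'" by (rule has_derivative_linear[OF assms])
  define d where "d = (\<Sum>b\<in>Basis. h' b *\<^sub>R b)"
  have h': "h' z = z \<bullet> d" for z
  proof -
    have "h' z = h' (\<Sum>b\<in>Basis. (z \<bullet> b) *\<^sub>R b)" by (simp add: euclidean_representation)
    also have "\<dots> = (\<Sum>b\<in>Basis. (z \<bullet> b) * h' b)"
      by (simp only: linear_sum[OF lin] linear_scale[OF lin] real_scaleR_def)
    also have "\<dots> = z \<bullet> d" by (simp add: d_def inner_sum_right mult.commute)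
    finally show ?thesis .
  qed
  then have "GDERIV h x :> d"
    using assms unfolding gderiv_def by presburger
  then show ?thesis by (simp add: GDERIV_imp_grad h')
qed

context smooth_rkhs
begin

lemma GDERIV_ext0:
  assumes "ext0 S h \<in> H" "x \<in> interior S"
  shows "GDERIV h x :> gradH (ext0 S h) x"
  unfolding gderiv_def
  by (rule has_derivative_transform_within_open[OF GDERIV_gradH[OF assms, unfolded gderiv_def] open_interior assms(2)])
    (use interior_subset in \<open>auto simp: ext0_def\<close>)

lemma grad_ext0: "ext0 S h \<in> H \<Longrightarrow> x \<in> interior S \<Longrightarrow> grad h x = gradH (ext0 S h) x"
  by (rule GDERIV_imp_grad[OF GDERIV_ext0])

lemma gradH_diff:
  assumes "h1 \<in> H" "h2 \<in> H" "x \<in> interior S"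
  shows "gradH (\<lambda>y. h1 y - h2 y) x = gradH h1 x - gradH h2 x"
proof -
  have "ip (kdiff b x) (\<lambda>y. h1 y - h2 y) = ip (kdiff b x) h1 - ip (kdiff b x) h2" for b
    using assms by (simp add: ip_sym[of "kdiff b x"] kdiff_in_H H_diff ip_diff)
  then show ?thesis by (simp add: gradH_def scaleR_left_diff_distrib sum_subtractf)
qed

lemma inner_grad_kernel:
  assumes "y \<in> S" "x \<in> S" shows "b \<bullet> grad (\<lambda>z. k z x) y = kdiff b y x"
  using has_derivative_inner_grad[OF kernel_derivative_fst[OF in_U[OF assms]]] assms
  by (simp add: kdiff_def ext0_def)

text \<open>The interpolant lies in the span of the Riesz representers of the interpolation
  functionals, and the error is orthogonal to that span.\<close>

lemma hermite_interpolant_error: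
  assumes X: "finite X" "X \<subseteq> interior S" and v: "ext0 S v \<in> H"
    and s: "hermite_interpolant k v X s"
  shows "ext0 S s \<in> H" and "nrm (\<lambda>x. ext0 S v x - ext0 S s x) \<le> nrm (ext0 S v)"
proof -
  obtain \<alpha> \<beta> where s_eq: "s = (\<lambda>x. \<Sum>y\<in>X. \<alpha> y * k y x + \<beta> y \<bullet> grad (\<lambda>z. k z x) y)"
    and interp: "\<And>y. y \<in> X \<Longrightarrow> s y = v y" "\<And>y. y \<in> X \<Longrightarrow> grad s y = grad v y"
    using s unfolding hermite_interpolant_def by auto
  have XS: "y \<in> S" "y \<in> interior S" if "y \<in> X" for y using that X interior_subset by blast+
  have parts: "(\<lambda>x. \<Sum>y\<in>X. \<alpha> y * ext0 S (k y) x) \<in> H" "(\<lambda>x. \<Sum>y\<in>X. 1 * kdiff (\<beta> y) y x) \<in> H"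
    by (rule sum_in_H; use XS X in \<open>auto intro: kernel_in_H kdiff_in_H\<close>)+
  have s_rep: "ext0 S s = (\<lambda>x. 1 * (\<Sum>y\<in>X. \<alpha> y * ext0 S (k y) x) + 1 * (\<Sum>y\<in>X. 1 * kdiff (\<beta> y) y x))"
  proof
    fix x
    show "ext0 S s x = 1 * (\<Sum>y\<in>X. \<alpha> y * ext0 S (k y) x) + 1 * (\<Sum>y\<in>X. 1 * kdiff (\<beta> y) y x)"
    proof (cases "x \<in> S")
      case True
      then have "s x = (\<Sum>y\<in>X. \<alpha> y * k y x + kdiff (\<beta> y) y x)"
        unfolding s_eq using XS by (intro sum.cong) (simp_all add: inner_grad_kernel)
      then show ?thesis using True by (simp add: ext0_def sum.distrib)
    qed (simp add: ext0_def kdiff_def)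
  qed
  show sH: "ext0 S s \<in> H" unfolding s_rep by (rule H_comb[OF parts])
  define e where "e = (\<lambda>x. ext0 S v x - ext0 S s x)"
  have eH: "e \<in> H" unfolding e_def by (rule H_diff[OF v sH])
  have e0: "e y = 0" if "y \<in> X" for y
    using interp[OF that] by (simp add: e_def ext0_def)
  have grad_e0: "gradH e y = 0" if "y \<in> X" for y
    using interp(2)[OF that] XS(2)[OF that] v sH
    unfolding e_def by (simp only: gradH_diff) (simp add: grad_ext0)
  have "ip (ext0 S s) e = (\<Sum>y\<in>X. \<alpha> y * ip (ext0 S (k y)) e) + (\<Sum>y\<in>X. 1 * ip (kdiff (\<beta> y) y) e)"
    unfolding s_rep ip_comb[OF parts eH] using X XS eH
    by (subst (1 2) ip_sum) (auto intro: kernel_in_H kdiff_in_H)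
  also have "\<dots> = 0"
    using XS e0 grad_e0 eH by (simp add: reproducing ip_kdiff)
  finally have "ip e e = ip (ext0 S v) e"
    using ip_diff[OF v sH eH] by (simp add: e_def)
  then have "(nrm e)\<^sup>2 \<le> nrm (ext0 S v) * nrm e"
    using cauchy_schwarz[OF v eH] nrm_square[OF eH] by simp
  then show "nrm e \<le> nrm (ext0 S v)"
    using nrm_nonneg[OF eH] nrm_nonneg[OF v] by (cases "nrm e = 0") (auto simp: power2_eq_square)
qed

text \<open>The quantifier order carries the independence claim: one constant, built from the kernel
  and the norm of \<open>v\<close>, serves every node set and every interpolant.\<close>

lemma hermite_gradient_error_lipschitz:
  assumes v: "ext0 S v \<in> H"
  shows "\<exists>L. \<forall>X s. finite X \<longrightarrow> X \<subseteq> interior S \<longrightarrow> hermite_interpolant k v X s \<longrightarrow>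
      L-lipschitz_on (interior S) (\<lambda>x. grad v x - grad s x)"
proof -
  obtain M where M: "0 < M" "\<And>h x y. h \<in> H \<Longrightarrow> x \<in> interior S \<Longrightarrow> y \<in> interior S \<Longrightarrow>
       norm (gradH h x - gradH h y) \<le> M * nrm h * norm (x - y)"
    using gradH_lipschitz by blast
  show ?thesis
  proof (intro exI[of _ "M * nrm (ext0 S v)"] allI impI, rule lipschitz_onI)
    fix X s x y assume Xs: "finite X" "X \<subseteq> interior S" "hermite_interpolant k v X s"
      and xy: "x \<in> interior S" "y \<in> interior S"
    note err = hermite_interpolant_error[OF Xs(1,2) v Xs(3)]
    define e where "e = (\<lambda>x. ext0 S v x - ext0 S s x)"
    have eH: "e \<in> H" unfolding e_def by (rule H_diff[OF v err(1)])
    have eq: "grad v z - grad s z = gradH e z" if "z \<in> interior S" for z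
      using that v err(1) by (simp add: grad_ext0 e_def gradH_diff)
    have "norm (gradH e x - gradH e y) \<le> M * nrm e * norm (x - y)" by (intro M eH xy)
    also have "\<dots> \<le> M * nrm (ext0 S v) * norm (x - y)"
      using M(1) err(2) by (intro mult_right_mono mult_left_mono) (auto simp: e_def)
    finally show "dist (grad v x - grad s x) (grad v y - grad s y) \<le> M * nrm (ext0 S v) * dist x y"
      by (simp add: eq xy dist_norm)
  qed (use M nrm_nonneg[OF v] in simp)
qed

end

text \<open>The interface to the control problem: the Hilbert space, its inner product and the
  derivatives of \<open>k\<close> are chosen inside and do not appear in the conclusions. Two of the
  four derivatives are unfolded from \<open>Cm_on\<close>, and the convex hull serves as the convex
  superset.\<close>

lemma rkhs_hermite_gradient:
  fixes k :: "'a::euclidean_space \<Rightarrow> 'a \<Rightarrow> real"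
  assumes "compact S" "Cm_near 4 ((convex hull S) \<times> (convex hull S)) (\<lambda>(x, y). k x y)"
    and "v \<in> rkhs S k"
  shows "\<And>x. x \<in> interior S \<Longrightarrow> GDERIV v x :> grad v x"
    and "\<exists>L. \<forall>X s. finite X \<longrightarrow> X \<subseteq> interior S \<longrightarrow> hermite_interpolant k v X s \<longrightarrow>
      L-lipschitz_on (interior S) (\<lambda>x. grad v x - grad s x)"
proof -
  obtain U where U: "open U" "(convex hull S) \<times> (convex hull S) \<subseteq> U"
    and "Cm_on (Suc (Suc 2)) U (\<lambda>(x, y). k x y)"
    using assms(2) unfolding Cm_near_def by (auto simp: eval_nat_numeral)
  then obtain k' where k': "\<And>p. p \<in> U \<Longrightarrow> ((\<lambda>(x, y). k x y) has_derivative k' p) (at p)"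
    and "\<forall>w. Cm_on (Suc 2) U (\<lambda>p. k' p w)"
    by (subst (asm) Cm_on.simps(2)) blast
  then have "\<forall>w. \<exists>h. (\<forall>p\<in>U. ((\<lambda>p. k' p (w, 0)) has_derivative h p) (at p)) \<and>
      (\<forall>z. Cm_on 2 U (\<lambda>p. h p z))"
    by (subst (asm) Cm_on.simps(2)) blast
  then obtain k'' where k'': "\<And>w p. p \<in> U \<Longrightarrow> ((\<lambda>p. k' p (w, 0)) has_derivative k'' w p) (at p)"
    "\<And>w z. Cm_on 2 U (\<lambda>p. k'' w p z)"
    by metis
  obtain H ip where H: "is_rkhs S k H ip" and v: "ext0 S v \<in> H"
    using assms(3) unfolding rkhs_def by blast
  interpret smooth_rkhs S k H ip "convex hull S" U k' k''
    by unfold_locales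
      (assumption | rule H U k' k'' compact_convex_hull assms(1) convex_convex_hull hull_subset)+
  show "GDERIV v x :> grad v x" if "x \<in> interior S" for x
    using GDERIV_ext0[OF v that] GDERIV_imp_grad by metis
  show "\<exists>L. \<forall>X s. finite X \<longrightarrow> X \<subseteq> interior S \<longrightarrow> hermite_interpolant k v X s \<longrightarrow>
      L-lipschitz_on (interior S) (\<lambda>x. grad v x - grad s x)"
    by (rule hermite_gradient_error_lipschitz[OF v])
qed

section \<open>Perturbed flows\<close>

text \<open>Boundedness is bundled in because a product of Lipschitz maps need not be Lipschitz
  without it. The bundle is stable under sums, linear and bilinear maps, from which the closed-loop
  fields are built.\<close>

definition bounded_lipschitz_on :: "'a::metric_space set \<Rightarrow> ('a \<Rightarrow> 'b::real_normed_vector) \<Rightarrow> bool" where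
  "bounded_lipschitz_on W F \<longleftrightarrow> (\<exists>L. L-lipschitz_on W F) \<and> bounded (F ` W)"

lemma bounded_lipschitz_on_subset:
  assumes "bounded_lipschitz_on W F" "V \<subseteq> W"
  shows "bounded_lipschitz_on V F"
proof -
  obtain L where "L-lipschitz_on W F" using assms(1) unfolding bounded_lipschitz_on_def by blast
  then have "L-lipschitz_on V F" by (rule lipschitz_on_subset) fact
  moreover have "bounded (F ` V)"
    using assms unfolding bounded_lipschitz_on_def by (metis bounded_subset image_mono)
  ultimately show ?thesis unfolding bounded_lipschitz_on_def by blast
qed

lemma bounded_lipschitz_onI_bounded_domain:
  fixes F :: "'a::heine_borel \<Rightarrow> 'b::euclidean_space"
  assumes "L-lipschitz_on W F" "bounded W"
  shows "bounded_lipschitz_on W F"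
proof -
  have "bounded (F ` W)"
    by (rule bounded_uniformly_continuous_image[OF lipschitz_on_uniformly_continuous[OF assms(1)] assms(2)])
  then show ?thesis using assms(1) unfolding bounded_lipschitz_on_def by blast
qed

lemma bounded_lipschitz_on_add:
  assumes "bounded_lipschitz_on W F" "bounded_lipschitz_on W G"
  shows "bounded_lipschitz_on W (\<lambda>x. F x + G x)"
proof -
  obtain L M where "L-lipschitz_on W F" "M-lipschitz_on W G"
    using assms unfolding bounded_lipschitz_on_def by blast
  then have "(L + M)-lipschitz_on W (\<lambda>x. F x + G x)" by (rule lipschitz_on_add)
  moreover have "bounded ((\<lambda>x. F x + G x) ` W)"
    using assms unfolding bounded_lipschitz_on_def by (intro bounded_plus_comp) auto
  ultimately show ?thesis unfolding bounded_lipschitz_on_def by blast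
qed

lemma bounded_lipschitz_on_linear:
  assumes "bounded_linear T" "bounded_lipschitz_on W F"
  shows "bounded_lipschitz_on W (\<lambda>x. T (F x))"
proof -
  interpret T: bounded_linear T by fact
  obtain L where L: "L-lipschitz_on W F" and b: "bounded (F ` W)"
    using assms(2) unfolding bounded_lipschitz_on_def by blast
  obtain B where "B-lipschitz_on (F ` W) T" using T.lipschitz_boundE by blast
  from lipschitz_on_compose2[OF L this] bounded_linear_image[OF b assms(1)]
  show ?thesis unfolding bounded_lipschitz_on_def by (auto simp: image_image)
qed

lemma bounded_lipschitz_on_bilinear:
  assumes "bounded_bilinear mul" "bounded_lipschitz_on W F" "bounded_lipschitz_on W G"
  shows "bounded_lipschitz_on W (\<lambda>x. mul (F x) (G x))"
proof -
  interpret bounded_bilinear mul by fact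
  obtain L1 B1 where F: "L1-lipschitz_on W F" "\<And>x. x \<in> W \<Longrightarrow> norm (F x) \<le> B1"
    using assms(2) unfolding bounded_lipschitz_on_def bounded_iff by auto
  obtain L2 B2 where G: "L2-lipschitz_on W G" "\<And>x. x \<in> W \<Longrightarrow> norm (G x) \<le> B2"
    using assms(3) unfolding bounded_lipschitz_on_def bounded_iff by auto
  obtain K where K: "0 < K" "\<And>a b. norm (mul a b) \<le> norm a * norm b * K"
    using pos_bounded by blast
  have L: "0 \<le> L1" "0 \<le> L2" using lipschitz_on_nonneg F(1) G(1) by blast+
  have "(K * (L1 * \<bar>B2\<bar> + \<bar>B1\<bar> * L2))-lipschitz_on W (\<lambda>x. mul (F x) (G x))"
  proof (rule lipschitz_onI)
    show "0 \<le> K * (L1 * \<bar>B2\<bar> + \<bar>B1\<bar> * L2)"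
      using K(1) L by simp
    fix x y assume xy: "x \<in> W" "y \<in> W"
    have "mul (F x) (G x) - mul (F y) (G y) = mul (F x - F y) (G x) + mul (F y) (G x - G y)"
      by (simp add: diff_left diff_right)
    then have "dist (mul (F x) (G x)) (mul (F y) (G y))
        \<le> norm (mul (F x - F y) (G x)) + norm (mul (F y) (G x - G y))"
      by (simp add: dist_norm norm_triangle_ineq)
    also have "\<dots> \<le> norm (F x - F y) * norm (G x) * K + norm (F y) * norm (G x - G y) * K"
      by (intro add_mono K)
    also have "\<dots> \<le> (L1 * dist x y) * \<bar>B2\<bar> * K + \<bar>B1\<bar> * (L2 * dist x y) * K"
      using lipschitz_onD[OF F(1) xy] lipschitz_onD[OF G(1) xy] F(2)[OF xy(2)] G(2)[OF xy(1)] K(1) L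
      by (intro add_mono mult_right_mono mult_mono) (auto simp: dist_norm)
    also have "\<dots> = K * (L1 * \<bar>B2\<bar> + \<bar>B1\<bar> * L2) * dist x y" by (simp add: algebra_simps)
    finally show "dist (mul (F x) (G x)) (mul (F y) (G y))
        \<le> K * (L1 * \<bar>B2\<bar> + \<bar>B1\<bar> * L2) * dist x y" .
  qed
  moreover have "norm (mul (F x) (G x)) \<le> \<bar>B1\<bar> * \<bar>B2\<bar> * K" if "x \<in> W" for x
  proof -
    have "norm (mul (F x) (G x)) \<le> norm (F x) * norm (G x) * K" by (rule K)
    also have "\<dots> \<le> \<bar>B1\<bar> * \<bar>B2\<bar> * K"
      using F(2)[OF that] G(2)[OF that] K(1) by (intro mult_right_mono mult_mono) auto
    finally show ?thesis .
  qed
  ultimately show ?thesis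
    unfolding bounded_lipschitz_on_def bounded_iff by auto
qed

text \<open>The tube need not be convex, so the mean value estimate is made on balls inside the open
  neighbourhood, and compactness of \<open>S\<close> turns the local constants into one. The
  singleton \<open>{0}\<close> is a dummy time for \<open>local_lipschitz\<close>.\<close>

lemma Cm_near_1_imp_bounded_lipschitz_on:
  fixes F :: "'a::euclidean_space \<Rightarrow> 'b::euclidean_space"
  assumes "Cm_near 1 S F" "compact S"
  shows "bounded_lipschitz_on S F"
proof -
  obtain U F' where U: "open U" "S \<subseteq> U"
    and F': "\<And>x. x \<in> U \<Longrightarrow> (F has_derivative F' x) (at x)"
    and cont: "\<And>w. continuous_on U (\<lambda>x. F' x w)"
    using assms(1) unfolding Cm_near_def by auto
  have "local_lipschitz {0 :: real} S (\<lambda>_. F)"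
  proof (rule local_lipschitzI)
    fix t :: real and x assume "x \<in> S"
    then obtain u where u: "u > 0" "cball x u \<subseteq> U"
      using U open_contains_cball by blast
    have "\<exists>B. \<forall>y\<in>cball x u. norm (F' y b) \<le> B" for b
      using compact_imp_bounded[OF compact_continuous_image[OF continuous_on_subset[OF cont u(2)] compact_cball]]
      by (auto simp: bounded_iff)
    then obtain B where B: "\<And>b y. y \<in> cball x u \<Longrightarrow> norm (F' y b) \<le> B b" by metis
    have "(\<Sum>b\<in>Basis. \<bar>B b\<bar>)-lipschitz_on (cball x u) F"
    proof (rule bounded_derivative_imp_lipschitz)
      fix y assume y: "y \<in> cball x u"
      then have yU: "y \<in> U" using u by blast
      show "(F has_derivative F' y) (at y within cball x u)"
        by (rule has_derivative_at_withinI[OF F'[OF yU]])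
      show "onorm (F' y) \<le> (\<Sum>b\<in>Basis. \<bar>B b\<bar>)"
      proof (rule onorm_le)
        fix h
        have lin: "linear (F' y)" by (rule has_derivative_linear[OF F'[OF yU]])
        have "F' y h = F' y (\<Sum>b\<in>Basis. (h \<bullet> b) *\<^sub>R b)" by (simp add: euclidean_representation)
        also have "\<dots> = (\<Sum>b\<in>Basis. (h \<bullet> b) *\<^sub>R F' y b)"
          by (simp only: linear_sum[OF lin] linear_scale[OF lin])
        also have "norm \<dots> \<le> (\<Sum>b\<in>Basis. \<bar>B b\<bar> * norm h)"
        proof (rule sum_norm_le)
          fix b :: 'a assume "b \<in> Basis"
          then show "norm ((h \<bullet> b) *\<^sub>R F' y b) \<le> \<bar>B b\<bar> * norm h"
            using mult_mono[of "norm (F' y b)" "\<bar>B b\<bar>" "\<bar>h \<bullet> b\<bar>" "norm h"] B[OF y, of b] Basis_le_norm[of b h]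
            by (simp add: mult.commute)
        qed
        finally show "norm (F' y h) \<le> (\<Sum>b\<in>Basis. \<bar>B b\<bar>) * norm h"
          by (simp add: sum_distrib_right)
      qed
    qed (auto simp: sum_nonneg)
    then have "(\<Sum>b\<in>Basis. \<bar>B b\<bar>)-lipschitz_on (cball x u \<inter> S) F"
      by (rule lipschitz_on_subset) auto
    with u show "\<exists>u>0. \<exists>L. \<forall>t\<in>cball t u \<inter> {0}. L-lipschitz_on (cball x u \<inter> S) F" by blast
  qed
  then obtain L where "L-lipschitz_on S F"
    using local_lipschitz_compact_implies_lipschitz[OF _ assms(2), of "{0}" "\<lambda>_. F"] by auto
  then show ?thesis
    using assms(2) compact_imp_bounded bounded_lipschitz_onI_bounded_domain by blast
qed

text \<open>Makes a field that is controlled only in a tube accessible to a global existence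
  theorem: it is multiplied by a cut-off that falls linearly with the distance to \<open>K\<close>,
  from 1 at \<open>\<rho>\<close> to 0 at \<open>\<delta>\<close>, and set to 0 beyond.\<close>

lemma lipschitz_cutoff:
  fixes F :: "'a::euclidean_space \<Rightarrow> 'b::real_normed_vector"
  assumes "bounded_lipschitz_on {x. infdist x K < \<delta>} F" "\<rho> < \<delta>" "K \<noteq> {}"
  obtains G L where "L-lipschitz_on UNIV G" "\<And>x. infdist x K \<le> \<rho> \<Longrightarrow> G x = F x"
proof -
  define W where "W = {x. infdist x K < \<delta>}"
  define c where "c = 1 / (\<delta> - \<rho>)"
  have "c > 0" using assms(2) by (simp add: c_def)
  define \<psi> where "\<psi> x = max 0 (min 1 ((\<delta> - infdist x K) * c))" for x
  have psi_lip: "\<bar>\<psi> x - \<psi> y\<bar> \<le> c * dist x y" for x y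
  proof -
    have "\<bar>\<psi> x - \<psi> y\<bar> \<le> \<bar>(\<delta> - infdist x K) * c - (\<delta> - infdist y K) * c\<bar>"
      unfolding \<psi>_def by linarith
    also have "\<dots> = c * \<bar>infdist x K - infdist y K\<bar>"
      using \<open>c > 0\<close> by (simp add: abs_mult left_diff_distrib[symmetric] abs_minus_commute)
    also have "\<dots> \<le> c * dist x y"
      using infdist_triangle_abs[of x K y] \<open>c > 0\<close> by (intro mult_left_mono) auto
    finally show ?thesis .
  qed
  have psi01: "0 \<le> \<psi> x" "\<psi> x \<le> 1" for x by (auto simp: \<psi>_def)
  have psi_out: "\<psi> x = 0" if "x \<notin> W" for x
    using that \<open>c > 0\<close> mult_nonpos_nonneg[of "\<delta> - infdist x K" c] by (simp add: \<psi>_def W_def)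
  have psi_in: "\<psi> x = 1" if "infdist x K \<le> \<rho>" for x
  proof -
    have "1 \<le> (\<delta> - infdist x K) * c"
      using that assms(2) by (simp add: c_def field_simps)
    then show ?thesis by (simp add: \<psi>_def)
  qed
  obtain L B where L: "L-lipschitz_on W F" and B: "\<And>x. x \<in> W \<Longrightarrow> norm (F x) \<le> B"
    using assms(1) unfolding bounded_lipschitz_on_def bounded_iff W_def[symmetric] by auto
  have "L \<ge> 0" by (rule lipschitz_on_nonneg[OF L])
  define G where "G x = (if x \<in> W then \<psi> x *\<^sub>R F x else 0)" for x
  \<comment> \<open>One point in \<open>W\<close> suffices: if the other lies outside, its value and
    its cut-off are both 0, so the difference of the cut-offs controls \<open>G x\<close>.\<close>
  have aux: "norm (G x - G y) \<le> (c * \<bar>B\<bar> + L) * dist x y" if x: "x \<in> W" for x y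
  proof (cases "y \<in> W")
    case True
    have "G x - G y = (\<psi> x - \<psi> y) *\<^sub>R F x + \<psi> y *\<^sub>R (F x - F y)"
      using x True by (simp add: G_def algebra_simps)
    then have "norm (G x - G y) \<le> \<bar>\<psi> x - \<psi> y\<bar> * norm (F x) + \<psi> y * norm (F x - F y)"
      using norm_triangle_ineq[of "(\<psi> x - \<psi> y) *\<^sub>R F x" "\<psi> y *\<^sub>R (F x - F y)"] psi01(1)[of y] by simp
    also have "\<dots> \<le> (c * dist x y) * \<bar>B\<bar> + 1 * (L * dist x y)"
      using psi_lip[of x y] psi01[of y] B[OF x] lipschitz_onD[OF L x True] \<open>c > 0\<close> \<open>L \<ge> 0\<close>
      by (intro add_mono mult_mono) (auto simp: dist_norm)
    finally show ?thesis by (simp add: algebra_simps)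
  next
    case False
    have "norm (G x - G y) = \<bar>\<psi> x - \<psi> y\<bar> * norm (F x)"
      using x False psi_out[OF False] psi01(1)[of x] by (simp add: G_def)
    also have "\<dots> \<le> (c * dist x y) * \<bar>B\<bar>"
      using psi_lip[of x y] B[OF x] \<open>c > 0\<close> by (intro mult_mono) auto
    also have "\<dots> \<le> (c * \<bar>B\<bar> + L) * dist x y"
      using \<open>L \<ge> 0\<close> by (simp add: algebra_simps)
    finally show ?thesis .
  qed
  have "(c * \<bar>B\<bar> + L)-lipschitz_on UNIV G"
  proof (rule lipschitz_onI)
    fix x y
    show "dist (G x) (G y) \<le> (c * \<bar>B\<bar> + L) * dist x y"
    proof (cases "x \<in> W")
      case True
      then show ?thesis using aux[of x y] by (simp add: dist_norm)
    next
      case False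
      then show ?thesis
        using aux[of y x] \<open>c > 0\<close> \<open>L \<ge> 0\<close>
        by (cases "y \<in> W") (auto simp: dist_norm norm_minus_commute G_def)
    qed
  qed (use \<open>c > 0\<close> \<open>L \<ge> 0\<close> in simp)
  moreover have "G x = F x" if "infdist x K \<le> \<rho>" for x
    using that psi_in[OF that] assms(2) by (simp add: G_def W_def)
  ultimately show thesis by (rule that)
qed

lemma has_vector_derivative_imp_continuous_on:
  assumes "\<And>t. t \<in> S \<Longrightarrow> (y has_vector_derivative y' t) (at t within S)"
  shows "continuous_on S y"
  unfolding continuous_on_eq_continuous_within
proof
  fix t assume "t \<in> S"
  from has_vector_derivative_continuous[OF assms[OF this]] show "continuous (at t within S) y" .
qed

text \<open>\<open>Fs\<close> is arbitrary outside the tube, so the estimate has to come before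
  existence and uniqueness. It confines the solution of the cut-off equation to where the cut-off
  changes nothing, and every solution of the original equation to where \<open>Fs\<close> is
  Lipschitz.\<close>

lemma perturbed_flow:
  fixes F Fs :: "'a::euclidean_space \<Rightarrow> 'a"
  assumes "0 < T" "K \<noteq> {}" "0 \<le> L" "0 \<le> c"
    and q: "\<And>t. t \<in> {0..T} \<Longrightarrow> q t \<in> K"
      "\<And>t. t \<in> {0..T} \<Longrightarrow> (q has_vector_derivative F (q t)) (at t within {0..T})"
    and Fs: "bounded_lipschitz_on {x. infdist x K < \<delta>} Fs"
    and pert: "\<And>t y. t \<in> {0..T} \<Longrightarrow> infdist y K < \<delta> \<Longrightarrow> norm (F (q t) - Fs y) \<le> L * norm (q t - y) + c"
    and B: "c * T * exp (L * T) \<le> B" "B < \<delta>"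
  shows "\<exists>y. y 0 = q 0 \<and> (\<forall>t\<in>{0..T}. (y has_vector_derivative Fs (y t)) (at t within {0..T})) \<and>
    (\<forall>z. z 0 = q 0 \<and> (\<forall>t\<in>{0..T}. (z has_vector_derivative Fs (z t)) (at t within {0..T})) \<longrightarrow>
       (\<forall>t\<in>{0..T}. z t = y t)) \<and>
    (\<forall>t\<in>{0..T}. norm (q t - y t) \<le> B)"
proof -
  \<comment> \<open>A level strictly between \<open>B\<close> and \<open>\<delta>\<close> provides
    the gap for \<open>bootstrap_le\<close> and room for the cut-off.\<close>
  define B' where "B' = (B + \<delta>) / 2"
  have B': "B < B'" "B' < \<delta>" using B by (auto simp: B'_def)
  have "0 \<le> B" using B(1) assms(1,4) by (meson exp_ge_zero less_imp_le mult_nonneg_nonneg order_trans)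
  have near: "infdist y K \<le> norm (q t - y)" if "t \<in> {0..T}" for t y
    using infdist_le[OF q(1)[OF that], of y] by (simp add: dist_norm norm_minus_commute)
  \<comment> \<open>The equation is demanded only while \<open>y\<close> stays within
    \<open>B'\<close> of \<open>q\<close>; this weak form covers solutions of both the cut-off and
    the original equation.\<close>
  have apriori: "norm (q t - y t) \<le> B"
    if "y 0 = q 0" and cont: "continuous_on {0..T} y"
      and y: "\<And>t. t \<in> {0..T} \<Longrightarrow> norm (q t - y t) \<le> B' \<Longrightarrow> (y has_vector_derivative Fs (y t)) (at t within {0..T})"
      and "t \<in> {0..T}" for y t
  proof (rule bootstrap_le[where u = "\<lambda>t. norm (q t - y t)", OF _ _ B'(1) _ \<open>t \<in> {0..T}\<close>])
    show "continuous_on {0..T} (\<lambda>t. norm (q t - y t))"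
      by (intro continuous_intros cont has_vector_derivative_imp_continuous_on[OF q(2)])
    show "norm (q 0 - y 0) \<le> B" using \<open>y 0 = q 0\<close> \<open>0 \<le> B\<close> by simp
    fix \<tau> assume \<tau>: "\<tau> \<in> {0..T}" and small: "\<And>s. s \<in> {0..\<tau>} \<Longrightarrow> norm (q s - y s) \<le> B'"
    have "norm (q \<tau> - y \<tau>) \<le> (norm (q 0 - y 0) + c * \<tau>) * exp (L * \<tau>)"
    proof (rule gronwall_norm[where T = \<tau> and z' = "\<lambda>t. F (q t) - Fs (y t)"])
      fix s assume s: "s \<in> {0..\<tau>}"
      then have sT: "s \<in> {0..T}" using \<tau> by simp
      have "((\<lambda>t. q t - y t) has_vector_derivative F (q s) - Fs (y s)) (at s within {0..T})"
        by (intro has_vector_derivative_diff q y sT small s)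
      then show "((\<lambda>t. q t - y t) has_vector_derivative F (q s) - Fs (y s)) (at s within {0..\<tau>})"
        by (rule has_vector_derivative_within_subset) (use \<tau> in auto)
      have "infdist (y s) K < \<delta>" using near[OF sT, of "y s"] small[OF s] B'(2) by linarith
      then show "norm (F (q s) - Fs (y s)) \<le> L * norm (q s - y s) + c" by (rule pert[OF sT])
    qed (use \<tau> assms in auto)
    also have "\<dots> \<le> c * T * exp (L * T)"
      using \<open>y 0 = q 0\<close> \<tau> assms(1,3,4) by (auto intro!: mult_mono mult_left_mono)
    finally show "norm (q \<tau> - y \<tau>) \<le> B" using B(1) by simp
  qed
  obtain G LG where G: "LG-lipschitz_on UNIV G" "\<And>x. infdist x K \<le> B' \<Longrightarrow> G x = Fs x"
    using lipschitz_cutoff[OF Fs B'(2) assms(2)] by blast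
  obtain y where y0: "y 0 = q 0"
    and y: "\<And>t. t \<in> {0..T} \<Longrightarrow> (y has_vector_derivative G (y t)) (at t within {0..T})"
    using picard_lindeloef_global[OF G(1) assms(1), of "q 0"] by blast
  have eqG: "G (y t) = Fs (y t)" if "t \<in> {0..T}" "norm (q t - y t) \<le> B'" for t
    using near[OF that(1), of "y t"] that(2) by (intro G(2)) linarith
  have yB: "norm (q t - y t) \<le> B" if "t \<in> {0..T}" for t
    using apriori[OF y0 has_vector_derivative_imp_continuous_on[OF y] _ that] y eqG by metis
  have yFs: "(y has_vector_derivative Fs (y t)) (at t within {0..T})" if "t \<in> {0..T}" for t
    using y[OF that] eqG[OF that] yB[OF that] B'(1) by simp
  obtain LF where LF: "LF-lipschitz_on {x. infdist x K < \<delta>} Fs"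
    using Fs unfolding bounded_lipschitz_on_def by blast
  have unique: "z t = y t"
    if "z 0 = q 0" and z: "\<And>t. t \<in> {0..T} \<Longrightarrow> (z has_vector_derivative Fs (z t)) (at t within {0..T})"
      and "t \<in> {0..T}" for z t
  proof -
    have zB: "norm (q t - z t) \<le> B" if "t \<in> {0..T}" for t
      by (rule apriori[OF \<open>z 0 = q 0\<close> has_vector_derivative_imp_continuous_on[OF z] z that])
    have "norm (z t - y t) \<le> (norm (z 0 - y 0) + 0 * t) * exp (LF * t)"
    proof (rule gronwall_norm[where T = T and z' = "\<lambda>t. Fs (z t) - Fs (y t)"])
      fix s assume s: "s \<in> {0..T}"
      show "((\<lambda>t. z t - y t) has_vector_derivative Fs (z s) - Fs (y s)) (at s within {0..T})"
        by (intro has_vector_derivative_diff z yFs s)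
      have "infdist (y s) K < \<delta>" "infdist (z s) K < \<delta>"
        using near[OF s, of "y s"] near[OF s, of "z s"] yB[OF s] zB[OF s] B(2) by linarith+
      then show "norm (Fs (z s) - Fs (y s)) \<le> LF * norm (z s - y s) + 0"
        using lipschitz_onD[OF LF, of "z s" "y s"] by (simp add: dist_norm)
    qed (use lipschitz_on_nonneg[OF LF] that in auto)
    then show ?thesis using \<open>z 0 = q 0\<close> y0 by simp
  qed
  show ?thesis using y0 yFs yB unique by blast
qed

section \<open>Optimal control\<close>

lemma bounded_bilinear_matrix_vector_mult:
  "bounded_bilinear (\<lambda>(A :: real^'m^'n) x. A *v x)"
  unfolding bilinear_conv_bounded_bilinear[symmetric] bilinear_def linear_iff
  by (simp add: matrix_vector_mult_add_rdistrib matrix_vector_right_distrib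
      matrix_vector_mult_scaleR scaleR_matrix_vector_assoc)

lemma bounded_bilinear_matrix_matrix_mult:
  "bounded_bilinear (\<lambda>(A :: real^'m^'n) (B :: real^'p^'m). A ** B)"
  unfolding bilinear_conv_bounded_bilinear[symmetric] bilinear_def linear_iff
  by (simp add: matrix_matrix_mult_def vec_eq_iff sum.distrib algebra_simps sum_distrib_left)

lemma bounded_linear_transpose: "bounded_linear (transpose :: real^'m^'n \<Rightarrow> real^'n^'m)"
  by (rule linear_conv_bounded_linear[THEN iffD1]) (simp add: linear_iff transpose_def vec_eq_iff)

text \<open>Separating this matrix from the gradient exhibits the closed-loop field as affine in
  \<open>grad h\<close>, so a gradient error is simply multiplied by it.\<close>

definition feedback_matrix :: "(real^'n \<Rightarrow> real^'m^'n) \<Rightarrow> real^'m^'m \<Rightarrow> real^'n \<Rightarrow> real^'n^'n" where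
  "feedback_matrix g R x = - (1/2) *\<^sub>R (g x ** (matrix_inv R ** transpose (g x)))"

lemma mult_feedback: "g x *v feedback g R h x = feedback_matrix g R x *v grad h x"
  by (simp only: feedback_def feedback_matrix_def matrix_vector_mul_assoc
      matrix_vector_mult_scaleR scaleR_matrix_vector_assoc[symmetric])

lemma bounded_lipschitz_on_feedback_matrix:
  assumes "bounded_lipschitz_on W g"
  shows "bounded_lipschitz_on W (feedback_matrix g R)"
  unfolding feedback_matrix_def
  by (intro bounded_lipschitz_on_linear[OF bounded_linear_scaleR_right]
      bounded_lipschitz_on_bilinear[OF bounded_bilinear_matrix_matrix_mult]
      bounded_lipschitz_on_linear[OF bounded_bilinear.bounded_linear_right[OF bounded_bilinear_matrix_matrix_mult]]
      bounded_lipschitz_on_linear[OF bounded_linear_transpose] assms)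

lemma reach_set_mem: "x0 \<in> A \<Longrightarrow> 0 \<le> t \<Longrightarrow> xstar x0 t \<in> reach_set xstar A"
  unfolding reach_set_def by (rule subsetD[OF closure_subset]) blast

text \<open>The strict inequality gives an open set, hence one of interior points of the tube, as
  the derivative theory of the kernel space requires.\<close>

lemma infdist_less_subset_interior_reach_tube:
  assumes "reach_set xstar A \<noteq> {}"
  shows "{x. infdist x (reach_set xstar A) < \<delta>} \<subseteq> interior (reach_tube xstar A \<delta>)"
proof (rule interior_maximal)
  show "open {x. infdist x (reach_set xstar A) < \<delta>}"
    by (intro open_Collect_less continuous_intros)
  show "{x. infdist x (reach_set xstar A) < \<delta>} \<subseteq> reach_tube xstar A \<delta>"
  proof clarify
    fix x assume "infdist x (reach_set xstar A) < \<delta>"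
    then obtain y where y: "y \<in> reach_set xstar A" "dist x y < \<delta>"
      using assms by (auto simp: infdist_def cINF_less_iff)
    then have "x = y + (x - y)" "x - y \<in> cball 0 \<delta>" by (auto simp: dist_norm norm_minus_commute)
    with y(1) show "x \<in> reach_tube xstar A \<delta>" unfolding reach_tube_def by blast
  qed
qed

text \<open>The state equation is known only in integrated form. Under feedback its integrand is
  \<open>F (x s)\<close>; an indefinite integral is continuous, so this integrand is continuous as
  well and the trajectory is differentiable in the classical sense.\<close>

lemma control_process_solution:
  assumes cp: "control_process f g x0 x u"
    and F: "continuous_on W F" "\<And>t. 0 \<le> t \<Longrightarrow> x t \<in> W"
      "\<And>t. 0 \<le> t \<Longrightarrow> f (x t) + g (x t) *v u t = F (x t)"
  shows "x 0 = x0"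
    and "t \<in> {0..T} \<Longrightarrow> (x has_vector_derivative F (x t)) (at t within {0..T})"
proof -
  have int: "set_integrable lebesgue {0..t} (\<lambda>s. f (x s) + g (x s) *v u s)"
    and x_eq: "x t = x0 + set_lebesgue_integral lebesgue {0..t} (\<lambda>s. f (x s) + g (x s) *v u s)"
    if "0 \<le> t" for t
    using cp that unfolding control_process_def by auto
  have int': "(\<lambda>s. F (x s)) integrable_on {0..t}"
    and x_eq': "x t = x0 + integral {0..t} (\<lambda>s. F (x s))" if "0 \<le> t" for t
  proof -
    show "(\<lambda>s. F (x s)) integrable_on {0..t}"
      by (rule integrable_eq[OF set_lebesgue_integral_eq_integral(1)[OF int[OF that]]])
        (use F(3) in auto)
    have "integral {0..t} (\<lambda>s. f (x s) + g (x s) *v u s) = integral {0..t} (\<lambda>s. F (x s))"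
      by (rule integral_cong) (use F(3) in auto)
    then show "x t = x0 + integral {0..t} (\<lambda>s. F (x s))"
      using x_eq[OF that] set_lebesgue_integral_eq_integral(2)[OF int[OF that]] by simp
  qed
  show "x 0 = x0" using x_eq'[of 0] by simp
  assume t: "t \<in> {0..T}"
  then have "0 \<le> T" by simp
  have "continuous_on {0..T} (\<lambda>t. x0 + integral {0..t} (\<lambda>s. F (x s)))"
    by (intro continuous_intros indefinite_integral_continuous_1 int' \<open>0 \<le> T\<close>)
  then have "continuous_on {0..T} x"
    by (rule continuous_on_eq) (use x_eq' in auto)
  then have "continuous_on {0..T} (\<lambda>s. F (x s))"
    by (rule continuous_on_compose2[OF F(1)]) (use F(2) in auto)
  then have "((\<lambda>t. integral {0..t} (\<lambda>s. F (x s))) has_vector_derivative F (x t)) (at t within {0..T})"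
    by (rule integral_has_vector_derivative[OF _ t])
  from has_vector_derivative_add[OF has_vector_derivative_const[of x0] this]
  have "((\<lambda>t. x0 + integral {0..t} (\<lambda>s. F (x s))) has_vector_derivative F (x t)) (at t within {0..T})"
    by simp
  then show "(x has_vector_derivative F (x t)) (at t within {0..T})"
    by (rule has_vector_derivative_transform[OF t, where g = x, rotated]) (use x_eq' in auto)
qed

lemma pos_def_matrix_nonneg: "pos_def_matrix R \<Longrightarrow> 0 \<le> w \<bullet> (R *v w)"
  unfolding pos_def_matrix_def by (cases "w = 0") (auto intro: less_imp_le)

lemma finite_cost_imp_zero_mem:
  fixes x :: "real \<Rightarrow> real^'n"
  assumes "pos_def_matrix R" and r: "continuous_on UNIV r" "\<And>x. 0 \<le> r x" "\<And>x. r x = 0 \<longleftrightarrow> x = 0"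
    and K: "compact K" "\<And>t. 0 \<le> t \<Longrightarrow> x t \<in> K" and "cost r R x u < \<infinity>"
  shows "0 \<in> K"
proof (rule ccontr)
  assume "0 \<notin> K"
  have "K \<noteq> {}" using K(2)[of 0] by auto
  then obtain z where z: "z \<in> K" "\<And>y. y \<in> K \<Longrightarrow> r z \<le> r y"
    using continuous_attains_inf[OF K(1) _ continuous_on_subset[OF r(1)]] by auto
  have "z \<noteq> 0" using z(1) \<open>0 \<notin> K\<close> by auto
  then have "r z > 0" using r(2,3)[of z] by (simp add: less_le)
  have "(\<integral>\<^sup>+ (s::real). ennreal (r z) * indicator {0..} s \<partial>lebesgue) \<le> cost r R x u"
    unfolding cost_def
  proof (rule nn_integral_mono)
    fix s :: real
    show "ennreal (r z) * indicator {0..} s \<le> ennreal (r (x s) + u s \<bullet> (R *v u s)) * indicator {0..} s"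
      using z(2)[OF K(2)[of s]] pos_def_matrix_nonneg[OF assms(1), of "u s"]
      by (auto simp: indicator_def intro!: ennreal_leI)
  qed
  moreover have "(\<integral>\<^sup>+ (s::real). ennreal (r z) * indicator {0..} s \<partial>lebesgue) = \<infinity>"
  proof -
    have "emeasure lebesgue {0::real..} = \<infinity>"
    proof (rule ccontr)
      assume "\<not> ?thesis"
      then obtain N where "emeasure lebesgue {0::real..} < of_nat N"
        using ennreal_Ex_less_of_nat[of "emeasure lebesgue {0::real..}"] by (auto simp: top.not_eq_extremum)
      also have "\<dots> = emeasure lebesgue {0..real N}" by (simp add: ennreal_of_nat_eq_real_of_nat)
      also have "\<dots> \<le> emeasure lebesgue {0::real..}" by (rule emeasure_mono) auto
      finally show False by simp
    qed
    then show ?thesis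
      using \<open>r z > 0\<close> by (simp add: nn_integral_cmult_indicator ennreal_mult_top)
  qed
  ultimately show False using assms(7) by auto
qed

lemma value_fun_zero:
  assumes "f 0 = 0" "r 0 = 0"
  shows "value_fun f g r R 0 = 0"
proof -
  have "control_process f g 0 (\<lambda>_. 0) (\<lambda>_. 0)"
    unfolding control_process_def using assms(1) by (simp add: set_integrable_def set_lebesgue_integral_def)
  moreover have "cost r R (\<lambda>_. 0) (\<lambda>_. 0) = 0"
    unfolding cost_def using assms(2) by simp
  ultimately have "min_cost f g r R 0 \<le> 0"
    unfolding min_cost_def by (metis (mono_tags, lifting) Inf_lower mem_Collect_eq)
  then show ?thesis by (simp add: value_fun_def)
qed

lemma grad_zero_at_minimum:
  assumes "GDERIV h x :> grad h x" "\<And>y. h x \<le> h y"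
  shows "grad h x = 0"
proof -
  have "(\<lambda>z. z \<bullet> grad h x) = (\<lambda>_. 0)"
    using differential_zero_maxmin[of x UNIV h "\<lambda>z. z \<bullet> grad h x"] assms unfolding gderiv_def by auto
  then show ?thesis by (metis inner_eq_zero_iff)
qed

section \<open>What the two algorithms guarantee on termination\<close>

text \<open>Since \<open>D\<close> consists of 0 and whole trajectories, one can move forward in
  time inside \<open>D\<close> from any of its points. The recorded \<open>\<epsilon>\<close> is a
  distance to the previous data set, but enlarging \<open>D\<close> only decreases distances.
  Initially \<open>\<epsilon> = tol + 1\<close> exceeds \<open>tol\<close>, so the last claim is
  vacuous.\<close>

lemma greedy_exploration_structure:
  assumes "greedy_exploration xstar A tol D \<epsilon>"
  shows "0 \<in> D \<and> (\<forall>y\<in>D. y = 0 \<or> (\<exists>xa\<in>A. y \<in> xstar xa ` {0..} \<and> xstar xa ` {0..} \<subseteq> D)) \<and>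
    (\<epsilon> \<le> tol \<longrightarrow> (\<forall>x\<in>A. infdist x D \<le> tol))"
  using assms
proof (induction rule: greedy_exploration.induct)
  case (step D \<epsilon> xa)
  have "infdist x (D \<union> xstar xa ` {0..}) \<le> infdist xa D" if "x \<in> A" for x
  proof -
    have "infdist x (D \<union> xstar xa ` {0..}) \<le> infdist x D"
      using step.IH by (intro infdist_mono) auto
    then show ?thesis using step.hyps(4) that by force
  qed
  then have "infdist xa D \<le> tol \<longrightarrow> (\<forall>x\<in>A. infdist x (D \<union> xstar xa ` {0..}) \<le> tol)"
    by (meson order_trans)
  then show ?case using step.IH step.hyps(3) by (intro conjI ballI; blast)
qed auto

lemma vkoga_structure:
  assumes "vkoga k v D tol X s"
  shows "finite X \<and> X \<subseteq> D \<and> hermite_interpolant k v X s"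
  using assms
proof (induction rule: vkoga.induct)
  case (step X s x s')
  then show ?case by simp
qed (simp add: hermite_interpolant_def)

text \<open>Off \<open>X\<close> the termination test bounds the gradient error; on
  \<open>X\<close>, which the test skips, interpolation makes it 0.\<close>

lemma vkoga_output_structure:
  assumes "vkoga_output k v D tol s" "0 < tol"
  obtains X where "finite X" "X \<subseteq> D" "hermite_interpolant k v X s"
    "\<And>x. x \<in> D \<Longrightarrow> norm (grad v x - grad s x) \<le> tol"
proof -
  obtain X where X: "vkoga k v D tol X s" "\<forall>x\<in>D - X. hermite_err v s x \<le> tol"
    using assms(1) unfolding vkoga_output_def by blast
  note st = vkoga_structure[OF X(1)]
  have "norm (grad v x - grad s x) \<le> tol" if "x \<in> D" for x
  proof (cases "x \<in> X")
    case True
    then have "grad s x = grad v x" using st unfolding hermite_interpolant_def by blast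
    then show ?thesis using assms(2) by simp
  next
    case False
    then have "hermite_err v s x \<le> tol" using X(2) that by blast
    then show ?thesis unfolding hermite_err_def by linarith
  qed
  then show thesis using st by (intro that) auto
qed

text \<open>Continues a trajectory from an intermediate time \<open>t0\<close>; the hypothesis
  covers all intervals because \<open>t0 + T\<close> may exceed \<open>T\<close>.\<close>

lemma has_vector_derivative_shift_interval:
  assumes "\<And>S t. t \<in> {0..S} \<Longrightarrow> (y has_vector_derivative y' t) (at t within {0..S})"
    and "0 \<le> t0" "t \<in> {0..T}"
  shows "((\<lambda>s. y (t0 + s)) has_vector_derivative y' (t0 + t)) (at t within {0..T})"
proof -
  have "((\<lambda>s. t0 + s) has_vector_derivative 1) (at t within {0..T})"
    by (auto intro!: derivative_eq_intros simp: has_vector_derivative_def)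
  moreover have "(y has_vector_derivative y' (t0 + t)) (at (t0 + t) within (\<lambda>s. t0 + s) ` {0..T})"
    by (rule has_vector_derivative_within_subset[OF assms(1)[of "t0 + t" "t0 + T"]])
      (use assms(2,3) in auto)
  ultimately show ?thesis
    using vector_diff_chain_within[of "\<lambda>s. t0 + s" 1 t "{0..T}" y "y' (t0 + t)"] by (simp add: o_def)
qed

section \<open>The error estimate for the surrogate trajectories\<close>

theorem theorem6:
  fixes f :: "real^'n \<Rightarrow> real^'n"
    and g :: "real^'n \<Rightarrow> real^'m^'n"
    and r :: "real^'n \<Rightarrow> real"
    and R :: "real^'m^'m"
    and A \<Omega> :: "(real^'n) set"
    and xstar :: "real^'n \<Rightarrow> real \<Rightarrow> real^'n"
    and ustar :: "real^'n \<Rightarrow> real \<Rightarrow> real^'m"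
    and v :: "real^'n \<Rightarrow> real"
    and k :: "real^'n \<Rightarrow> real^'n \<Rightarrow> real"
    and \<delta> :: real
  assumes "f 0 = 0"
    and "continuous_on UNIV r" and "\<And>x. 0 \<le> r x" and "\<And>x. r x = 0 \<longleftrightarrow> x = 0"
    and "pos_def_matrix R"
    and "A \<noteq> {}" and "compact A"
    and "\<And>x0. x0 \<in> A \<Longrightarrow> optimal_process f g r R x0 (xstar x0) (ustar x0)"
    and v: "v = value_fun f g r R"
    and "\<And>x0 s. x0 \<in> A \<Longrightarrow> 0 \<le> s \<Longrightarrow> ustar x0 s = feedback g R v (xstar x0 s)"
    and "\<delta> > 0"
    and \<Omega>: "\<Omega> = reach_tube xstar A \<delta>" and "compact \<Omega>"
    and "kernel_on (convex hull \<Omega>) k" and "strictly_pos_def_on (convex hull \<Omega>) k"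
    and "Cm_near 4 ((convex hull \<Omega>) \<times> (convex hull \<Omega>)) (\<lambda>(x, y). k x y)"
    and "(min_cost f g r R \<longlongrightarrow> \<infinity>) at_infinity"
    and "\<And>x. x \<in> \<Omega> \<Longrightarrow> min_cost f g r R x < \<infinity>" and "v \<in> rkhs \<Omega> k"
    and "Cm_near 1 \<Omega> f" and "Cm_near 1 \<Omega> g"
  shows "\<forall>T>0. \<exists>C1>0. \<exists>C2>0. \<forall>tol_d>0. \<forall>tol_f>0. \<forall>D s.
           greedy_exploration_output xstar A tol_d D \<longrightarrow>
           vkoga_output k v D tol_f s \<longrightarrow>
           tol_d * C1 + tol_f * C2 < \<delta> \<longrightarrow>
           (\<forall>x0\<in>A. \<exists>xs. closed_loop_solution f g R s T x0 xs \<and>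
              (\<forall>y. closed_loop_solution f g R s T x0 y \<longrightarrow> (\<forall>t\<in>{0..T}. y t = xs t)) \<and>
              (\<forall>t\<in>{0..T}. norm (xstar x0 t - xs t) \<le> tol_d * C1 + tol_f * C2))"
proof -
  define K where "K = reach_set xstar A"
  define W where "W = {x. infdist x K < \<delta>}"
  define P where "P = feedback_matrix g R"
  define F where "F x = f x + P x *v grad v x" for x
  note r = assms(2-4) and optimal = assms(8) and \<delta> = \<open>\<delta> > 0\<close>

  have traj_K: "xstar x0 t \<in> K" if "x0 \<in> A" "0 \<le> t" for x0 t
    unfolding K_def using that by (rule reach_set_mem)
  have "K \<noteq> {}" using traj_K[of _ 0] \<open>A \<noteq> {}\<close> by auto
  have W_int: "W \<subseteq> interior \<Omega>"
    using infdist_less_subset_interior_reach_tube[of xstar A \<delta>] \<open>K \<noteq> {}\<close>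
    unfolding W_def K_def \<Omega> by simp
  then have W\<Omega>: "W \<subseteq> \<Omega>" using interior_subset by blast
  have KW: "K \<subseteq> W" using \<delta> by (auto simp: W_def)
  have "closed K" by (simp add: K_def reach_set_def)
  have "bounded W" using W\<Omega> \<open>compact \<Omega>\<close> bounded_subset compact_imp_bounded by blast
  then have "compact K"
    using \<open>closed K\<close> KW bounded_subset compact_eq_bounded_closed by blast

  note grad_v = rkhs_hermite_gradient(1)[OF \<open>compact \<Omega>\<close> assms(16) \<open>v \<in> rkhs \<Omega> k\<close>]
  obtain L2 where L2: "\<And>X s. finite X \<Longrightarrow> X \<subseteq> interior \<Omega> \<Longrightarrow> hermite_interpolant k v X s \<Longrightarrow>
      L2-lipschitz_on (interior \<Omega>) (\<lambda>x. grad v x - grad s x)"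
    using rkhs_hermite_gradient(2)[OF \<open>compact \<Omega>\<close> assms(16) \<open>v \<in> rkhs \<Omega> k\<close>] by blast
  have grad_0: "grad (\<lambda>_::real^'n. 0::real) x = 0" for x
    by (rule GDERIV_imp_grad[OF GDERIV_const])
  \<comment> \<open>The zero function interpolates at no nodes, so the uniform constant
    \<open>L2\<close> also serves \<open>grad v\<close> itself.\<close>
  have lip_v: "L2-lipschitz_on (interior \<Omega>) (grad v)"
    using L2[of "{}" "\<lambda>_. 0"] by (simp add: hermite_interpolant_def grad_0)
  have "L2 \<ge> 0" by (rule lipschitz_on_nonneg[OF lip_v])
  have bl_grad: "bounded_lipschitz_on W (grad v)"
    by (rule bounded_lipschitz_onI_bounded_domain[OF lipschitz_on_subset[OF lip_v W_int] \<open>bounded W\<close>])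
  have bl_f: "bounded_lipschitz_on W f" and bl_g: "bounded_lipschitz_on W g"
    using Cm_near_1_imp_bounded_lipschitz_on[OF _ \<open>compact \<Omega>\<close>] assms(20,21) bounded_lipschitz_on_subset W\<Omega>
    by blast+
  have bl_P: "bounded_lipschitz_on W P"
    unfolding P_def by (rule bounded_lipschitz_on_feedback_matrix[OF bl_g])
  have bl_F: "bounded_lipschitz_on W F"
    unfolding F_def
    by (intro bounded_lipschitz_on_add bl_f bl_P bl_grad
        bounded_lipschitz_on_bilinear[OF bounded_bilinear_matrix_vector_mult])
  then obtain L1 where L1: "L1-lipschitz_on W F" unfolding bounded_lipschitz_on_def by blast
  have "L1 \<ge> 0" by (rule lipschitz_on_nonneg[OF L1])
  obtain M where M: "M \<ge> 0" "\<And>x z. x \<in> W \<Longrightarrow> norm (P x *v z) \<le> M * norm z"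
  proof -
    obtain B where B: "\<And>x. x \<in> W \<Longrightarrow> norm (P x) \<le> B"
      using bl_P unfolding bounded_lipschitz_on_def bounded_iff by auto
    obtain C where C: "C > 0" "\<And>(Q :: real^'n^'n) z. norm (Q *v z) \<le> norm Q * norm z * C"
      using bounded_bilinear.pos_bounded[OF bounded_bilinear_matrix_vector_mult] by blast
    show ?thesis
    proof (rule that[of "\<bar>B\<bar> * C"])
      show "norm (P x *v z) \<le> \<bar>B\<bar> * C * norm z" if "x \<in> W" for x z
      proof -
        have "norm (P x *v z) \<le> norm (P x) * norm z * C" by (rule C)
        also have "\<dots> \<le> \<bar>B\<bar> * norm z * C"
          using B[OF that] C(1) by (intro mult_right_mono) auto
        finally show ?thesis by (simp add: mult_ac)
      qed
    qed (use C in simp)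
  qed

  have field: "f x + g x *v feedback g R h x = f x + P x *v grad h x" for h x
    by (simp add: mult_feedback P_def)
  have cont_F: "continuous_on W F" by (rule lipschitz_on_continuous_on[OF L1])
  have traj_W: "xstar x0 t \<in> W" if "x0 \<in> A" "0 \<le> t" for x0 t
    using traj_K[OF that] KW by blast
  have traj: "xstar x0 0 = x0"
    "t \<in> {0..S} \<Longrightarrow> (xstar x0 has_vector_derivative F (xstar x0 t)) (at t within {0..S})"
    if "x0 \<in> A" for x0 t S
  proof -
    have cp: "control_process f g x0 (xstar x0) (ustar x0)"
      using optimal[OF that] by (simp add: optimal_process_def)
    have eq: "f (xstar x0 t) + g (xstar x0 t) *v ustar x0 t = F (xstar x0 t)" if "0 \<le> t" for t
      by (simp add: assms(10)[OF \<open>x0 \<in> A\<close> that] field F_def)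
    note sol = control_process_solution[OF cp cont_F traj_W[OF that] eq]
    show "xstar x0 0 = x0" by (rule sol(1))
    show "t \<in> {0..S} \<Longrightarrow> (xstar x0 has_vector_derivative F (xstar x0 t)) (at t within {0..S})"
      by (rule sol(2))
  qed

  \<comment> \<open>The exploration starts from \<open>{0}\<close>, so 0 must lie in
    \<open>K\<close> for all of \<open>D\<close> to stay where gradients are controlled.\<close>
  have "0 \<in> K"
  proof -
    obtain x0 where x0: "x0 \<in> A" using \<open>A \<noteq> {}\<close> by blast
    have "x0 \<in> \<Omega>" using traj_W[OF x0, of 0] traj(1)[OF x0] W\<Omega> by auto
    have "cost r R (xstar x0) (ustar x0) \<le> min_cost f g r R x0"
      unfolding min_cost_def using optimal[OF x0] by (auto simp: optimal_process_def intro!: Inf_greatest)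
    also have "\<dots> < \<infinity>" by (rule assms(18)[OF \<open>x0 \<in> \<Omega>\<close>])
    finally have "cost r R (xstar x0) (ustar x0) < \<infinity>" .
    from finite_cost_imp_zero_mem[OF \<open>pos_def_matrix R\<close> r \<open>compact K\<close> traj_K[OF x0] this]
    show ?thesis .
  qed
  then have "0 \<in> W" "0 \<in> interior \<Omega>" using KW W_int by auto
  \<comment> \<open>The value function is nonnegative and vanishes at 0, so its gradient vanishes
    there and 0 is an equilibrium of \<open>F\<close>. This gives the starting point of
    \<open>D\<close> a constant trajectory.\<close>
  have "grad v 0 = 0"
  proof (rule grad_zero_at_minimum[OF grad_v[OF \<open>0 \<in> interior \<Omega>\<close>]])
    have "v 0 = 0" unfolding v using assms(1,4) by (intro value_fun_zero) auto
    then show "v 0 \<le> v y" for y by (simp add: v value_fun_def)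
  qed
  then have "F 0 = 0" using assms(1) by (simp add: F_def)

  \<comment> \<open>The path \<open>p\<close> shadows the optimal trajectory while staying in
    \<open>D\<close>, where VKOGA bounds the gradient error.\<close>
  have nearby: "\<exists>p. (\<forall>t\<in>{0..T}. p t \<in> D) \<and> D \<subseteq> K \<and>
      (\<forall>t\<in>{0..T}. norm (xstar x0 t - p t) \<le> 2 * tol_d * exp (L1 * T))"
    if "T > 0" "tol_d > 0" and D: "greedy_exploration_output xstar A tol_d D" and x0: "x0 \<in> A" for T tol_d D x0
  proof -
    from D obtain \<epsilon> where "greedy_exploration xstar A tol_d D \<epsilon>" "\<epsilon> \<le> tol_d"
      unfolding greedy_exploration_output_def by blast
    from greedy_exploration_structure[OF this(1)] this(2)
    have "0 \<in> D" and D_cases: "\<And>y. y \<in> D \<Longrightarrow> y = 0 \<or> (\<exists>xa\<in>A. y \<in> xstar xa ` {0..} \<and> xstar xa ` {0..} \<subseteq> D)"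
      and "infdist x0 D \<le> tol_d"
      using x0 by auto
    have "D \<subseteq> K"
    proof
      fix y assume "y \<in> D"
      from D_cases[OF this] show "y \<in> K" using \<open>0 \<in> K\<close> traj_K by auto
    qed
    \<comment> \<open>\<open>infdist\<close> is an infimum that need not be attained, as
      \<open>D\<close> is not known to be closed; the slack of a factor 2 buys an actual point
      \<open>y\<close>.\<close>
    have "infdist x0 D < 2 * tol_d" using \<open>infdist x0 D \<le> tol_d\<close> \<open>tol_d > 0\<close> by linarith
    moreover have "D \<noteq> {}" using \<open>0 \<in> D\<close> by blast
    ultimately obtain y where y: "y \<in> D" "dist x0 y < 2 * tol_d"
      by (auto simp: infdist_def cINF_less_iff)
    have "\<exists>p. p 0 = y \<and> (\<forall>t\<in>{0..T}. p t \<in> D) \<and>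
        (\<forall>t\<in>{0..T}. (p has_vector_derivative F (p t)) (at t within {0..T}))"
    proof (cases "y = 0")
      case True
      then show ?thesis
        using \<open>0 \<in> D\<close> \<open>F 0 = 0\<close> by (intro exI[of _ "\<lambda>_. 0"]) (auto intro: has_vector_derivative_const)
    next
      case False
      then obtain xa t0 where xa: "xa \<in> A" "0 \<le> t0" "y = xstar xa t0" "xstar xa ` {0..} \<subseteq> D"
        using D_cases[OF y(1)] by auto
      then show ?thesis
        by (intro exI[of _ "\<lambda>t. xstar xa (t0 + t)"] conjI ballI
            has_vector_derivative_shift_interval[OF traj(2)[OF xa(1)]]) auto
    qed
    then obtain p where p: "p 0 = y" "\<And>t. t \<in> {0..T} \<Longrightarrow> p t \<in> D"
      "\<And>t. t \<in> {0..T} \<Longrightarrow> (p has_vector_derivative F (p t)) (at t within {0..T})"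
      by blast
    have "norm (xstar x0 t - p t) \<le> 2 * tol_d * exp (L1 * T)" if t: "t \<in> {0..T}" for t
    proof -
      have "norm (xstar x0 t - p t) \<le> (norm (xstar x0 0 - p 0) + 0 * t) * exp (L1 * t)"
      proof (rule gronwall_norm[where T = T and z' = "\<lambda>t. F (xstar x0 t) - F (p t)"])
        fix s assume s: "s \<in> {0..T}"
        show "((\<lambda>t. xstar x0 t - p t) has_vector_derivative F (xstar x0 s) - F (p s)) (at s within {0..T})"
          by (intro has_vector_derivative_diff traj(2)[OF x0] p s)
        have "xstar x0 s \<in> W" "p s \<in> W" using traj_W[OF x0] p(2)[OF s] s \<open>D \<subseteq> K\<close> KW by auto
        from lipschitz_onD[OF L1 this]
        show "norm (F (xstar x0 s) - F (p s)) \<le> L1 * norm (xstar x0 s - p s) + 0"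
          by (simp add: dist_norm)
      qed (use \<open>L1 \<ge> 0\<close> t in auto)
      also have "\<dots> \<le> 2 * tol_d * exp (L1 * T)"
        using y(2) p(1) traj(1)[OF x0] t \<open>L1 \<ge> 0\<close> \<open>tol_d > 0\<close>
        by (auto simp: dist_norm intro!: mult_mono mult_left_mono)
      finally show ?thesis .
    qed
    with p(2) \<open>D \<subseteq> K\<close> show ?thesis by blast
  qed

  show ?thesis
  proof (intro allI impI)
    fix T :: real assume "T > 0"
    \<comment> \<open>\<open>E\<close> is the Gronwall factor of the perturbed flow. Its product
      with the defect \<open>c\<close> below is linear in the tolerances, with coefficients
      \<open>C1 - 1\<close> and \<open>C2 - 1\<close>; the summand 1 ensures positivity.\<close>
    define E where "E = T * exp ((L1 + M * L2) * T)"
    have "E \<ge> 0" using \<open>T > 0\<close> by (simp add: E_def)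
    define C1 where "C1 = M * (2 * L2 * exp (L1 * T)) * E + 1"
    define C2 where "C2 = M * E + 1"
    have C: "C1 > 0" "C2 > 0"
      using \<open>E \<ge> 0\<close> M(1) \<open>L2 \<ge> 0\<close> by (auto simp: C1_def C2_def intro!: add_nonneg_pos)
    have "\<exists>xs. closed_loop_solution f g R s T x0 xs \<and>
              (\<forall>y. closed_loop_solution f g R s T x0 y \<longrightarrow> (\<forall>t\<in>{0..T}. y t = xs t)) \<and>
              (\<forall>t\<in>{0..T}. norm (xstar x0 t - xs t) \<le> tol_d * C1 + tol_f * C2)"
      if tol: "tol_d > 0" "tol_f > 0" and D: "greedy_exploration_output xstar A tol_d D"
        and s: "vkoga_output k v D tol_f s" and small: "tol_d * C1 + tol_f * C2 < \<delta>" and x0: "x0 \<in> A"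
      for tol_d tol_f D s x0
    proof -
      obtain p where p: "\<And>t. t \<in> {0..T} \<Longrightarrow> p t \<in> D" and "D \<subseteq> K"
        and p_near: "\<And>t. t \<in> {0..T} \<Longrightarrow> norm (xstar x0 t - p t) \<le> 2 * tol_d * exp (L1 * T)"
        using nearby[OF \<open>T > 0\<close> tol(1) D x0] by blast
      obtain X where X: "finite X" "X \<subseteq> D" "hermite_interpolant k v X s"
        and err_D: "\<And>x. x \<in> D \<Longrightarrow> norm (grad v x - grad s x) \<le> tol_f"
        using vkoga_output_structure[OF s tol(2)] by blast
      have "X \<subseteq> interior \<Omega>" using X(2) \<open>D \<subseteq> K\<close> KW W_int by blast
      from lipschitz_on_subset[OF L2[OF X(1) this X(3)] W_int]
      have err_lip: "L2-lipschitz_on W (\<lambda>x. grad v x - grad s x)" .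
      define Fs where "Fs y = F y - P y *v (grad v y - grad s y)" for y
      have Fs: "f y + g y *v feedback g R s y = Fs y" for y
        unfolding field Fs_def F_def by (simp add: matrix_vector_mult_diff_distrib)
      have "bounded_lipschitz_on W (\<lambda>y. F y + (- 1) *\<^sub>R (P y *v (grad v y - grad s y)))"
        by (intro bounded_lipschitz_on_add bl_F bounded_lipschitz_on_linear[OF bounded_linear_scaleR_right]
            bounded_lipschitz_on_bilinear[OF bounded_bilinear_matrix_vector_mult] bl_P
            bounded_lipschitz_onI_bounded_domain[OF err_lip \<open>bounded W\<close>])
      then have bl_Fs: "bounded_lipschitz_on W Fs" by (simp add: Fs_def[abs_def])
      define c where "c = M * (tol_f + 2 * L2 * exp (L1 * T) * tol_d)"
      have "c \<ge> 0" using M(1) \<open>L2 \<ge> 0\<close> tol by (simp add: c_def)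
      have pert: "norm (F (xstar x0 t) - Fs y) \<le> (L1 + M * L2) * norm (xstar x0 t - y) + c"
        if t: "t \<in> {0..T}" and "infdist y K < \<delta>" for t y
      proof -
        let ?q = "xstar x0 t"
        have W: "y \<in> W" "?q \<in> W" "p t \<in> W"
          using that traj_W[OF x0] p[OF t] \<open>D \<subseteq> K\<close> KW by (auto simp: W_def)
        \<comment> \<open>The error at \<open>y\<close> is carried over from \<open>p t\<close> by
          its Lipschitz bound. The share \<open>norm (?q - y)\<close> of the distance adds
          \<open>M * L2\<close> to the Gronwall rate; the shadowing distance goes into
          \<open>c\<close>.\<close>
        have "norm (grad v y - grad s y) \<le> norm (grad v (p t) - grad s (p t))
            + norm ((grad v y - grad s y) - (grad v (p t) - grad s (p t)))"
          by (rule norm_triangle_sub)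
        also have "\<dots> \<le> tol_f + L2 * norm (y - p t)"
          using err_D[OF p[OF t]] lipschitz_onD[OF err_lip W(1,3)] by (simp add: dist_norm)
        also have "norm (y - p t) \<le> norm (?q - y) + 2 * tol_d * exp (L1 * T)"
          using p_near[OF t] norm_triangle_ineq[of "y - ?q" "?q - p t"] by (simp add: norm_minus_commute)
        finally have err: "norm (grad v y - grad s y)
            \<le> tol_f + L2 * (norm (?q - y) + 2 * tol_d * exp (L1 * T))"
          using \<open>L2 \<ge> 0\<close> by (simp add: mult_left_mono)
        have "norm (F ?q - Fs y) \<le> norm (F ?q - F y) + norm (P y *v (grad v y - grad s y))"
          using norm_triangle_ineq[of "F ?q - F y" "P y *v (grad v y - grad s y)"]
          by (simp add: Fs_def diff_diff_eq2 add_diff_eq diff_add_eq)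
        also have "\<dots> \<le> L1 * norm (?q - y) + M * (tol_f + L2 * (norm (?q - y) + 2 * tol_d * exp (L1 * T)))"
          using lipschitz_onD[OF L1 W(2,1)] M(2)[OF W(1), of "grad v y - grad s y"]
            mult_left_mono[OF err M(1)] by (simp add: dist_norm)
        also have "\<dots> = (L1 + M * L2) * norm (?q - y) + c"
          by (simp add: c_def algebra_simps)
        finally show ?thesis .
      qed
      have "c * T * exp ((L1 + M * L2) * T) = tol_d * (C1 - 1) + tol_f * (C2 - 1)"
        by (simp add: c_def C1_def C2_def E_def algebra_simps)
      also have "\<dots> \<le> tol_d * C1 + tol_f * C2"
        using tol by (simp add: algebra_simps)
      finally have bound: "c * T * exp ((L1 + M * L2) * T) \<le> tol_d * C1 + tol_f * C2" .
      have traj_K': "xstar x0 t \<in> K" if "t \<in> {0..T}" for t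
        using traj_K[OF x0] that by simp
      have "L1 + M * L2 \<ge> 0" using \<open>L1 \<ge> 0\<close> \<open>L2 \<ge> 0\<close> M(1) by simp
      from perturbed_flow[OF \<open>T > 0\<close> \<open>K \<noteq> {}\<close> this \<open>c \<ge> 0\<close> traj_K' traj(2)[OF x0] bl_Fs[unfolded W_def]
          pert bound small]
      show ?thesis
        unfolding closed_loop_solution_def Fs traj(1)[OF x0] by blast
    qed
    then show "\<exists>C1>0. \<exists>C2>0. \<forall>tol_d>0. \<forall>tol_f>0. \<forall>D s.
           greedy_exploration_output xstar A tol_d D \<longrightarrow>
           vkoga_output k v D tol_f s \<longrightarrow>
           tol_d * C1 + tol_f * C2 < \<delta> \<longrightarrow>
           (\<forall>x0\<in>A. \<exists>xs. closed_loop_solution f g R s T x0 xs \<and>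
              (\<forall>y. closed_loop_solution f g R s T x0 y \<longrightarrow> (\<forall>t\<in>{0..T}. y t = xs t)) \<and>
              (\<forall>t\<in>{0..T}. norm (xstar x0 t - xs t) \<le> tol_d * C1 + tol_f * C2))"
      by (intro exI[of _ C1] exI[of _ C2] conjI C allI impI ballI)
  qed
qed

end
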